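(* Let $\lambda_1,\dots,\lambda_n$ be distinct points in $\mathbb H_{1/2}$ and $w_1,\dots,w_n\in\mathbb D$. Suppose there exists $\varphi\in H^\infty(\mathbb H_0)\cap\mathcal D$ with $\|\varphi\|_\infty\le1$ and $\varphi(\lambda_j)=w_j$ for $j=1,\dots,n$. Then: (i) the matrix $[(1-\overline{w_i}w_j)\zeta(\overline{\lambda_i}+\lambda_j)]_{i,j=1}^n$ is positive semi-definite; (ii) the matrix $\Big[\frac{1-\overline{w_i}w_j}{\overline{\lambda_i}+\lambda_j}\Big]_{i,j=1}^n$ is positive semi-definite and has rank equal to $n$.
   Context: $\mathbb H_\delta=\{s\in\mathbb C:\operatorname{Re}s>\delta\}$; $\mathbb D$ is the open unit disc; $\zeta$ is the Riemann zeta function. $H^\infty(\mathbb H_0)$ is the space of bounded holomorphic functions on $\mathbb H_0$ with sup norm $\|\cdot\|_\infty$. $\mathcal D$ denotes the set of functions representable by a convergent Dirichlet series $\sum_n a_n n^{-s}$ in some right half-plane. *)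

theory Defs
  imports "HOL-Analysis.Analysis" "Jordan_Normal_Form.DL_Rank"
begin

definition halfplane :: "real \<Rightarrow> complex set" where
  "halfplane \<delta> = {s. Re s > \<delta>}"

text \<open>Riemann zeta function via its Dirichlet series; only used where Re s > 1.\<close>
definition zeta :: "complex \<Rightarrow> complex" where
  "zeta s = (\<Sum>n. 1 / (of_nat (Suc n)) powr s)"

definition dirichlet_representable :: "(complex \<Rightarrow> complex) \<Rightarrow> bool" where
  "dirichlet_representable f \<longleftrightarrow>
     (\<exists>(a::nat \<Rightarrow> complex) (\<sigma>::real). \<forall>s. Re s > \<sigma> \<longrightarrow>
        (\<lambda>n. a (Suc n) * (of_nat (Suc n)) powr (- s)) sums f s)"

definition Hinf_unit_ball :: "(complex \<Rightarrow> complex) \<Rightarrow> bool" where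
  "Hinf_unit_ball f \<longleftrightarrow> f holomorphic_on halfplane 0 \<and> (\<forall>s\<in>halfplane 0. norm (f s) \<le> 1)"

definition psd_mat :: "complex mat \<Rightarrow> bool" where
  "psd_mat A \<longleftrightarrow> A \<in> carrier_mat (dim_row A) (dim_row A) \<and>
     (\<forall>c \<in> carrier_vec (dim_row A).
        let q = (\<Sum>i<dim_row A. \<Sum>j<dim_row A. cnj (c $ i) * A $$ (i, j) * c $ j)
        in Im q = 0 \<and> Re q \<ge> 0)"

end

theory Submission
  imports Defs "HOL-Complex_Analysis.Complex_Analysis" "HOL-Probability.Characteristic_Functions"
    "HOL-Real_Asymp.Real_Asymp"
begin

text \<open>
  (i) The vertical Gaussian averages of \<open>\<phi>\<close> are Dirichlet series that converge absolutely on the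
  closed right half-plane and are still bounded by 1. For such a series, averaging
  \<open>|\<phi> V - Y|\<^sup>2\<close> over a vertical arithmetic progression, where \<open>V\<close> and \<open>Y\<close> are Dirichlet polynomials,
  shows that the transposed multiplication operator is a contraction on \<open>\<ell>\<^sup>2\<close>; applied to the vectors
  \<open>(n powr - \<lambda>\<^sub>j)\<close> this is the claim for the average. Then let the Gaussians shrink.

  (ii) The same averaging argument with frequencies \<open>0, 1, 2, \<dots>\<close> in place of \<open>ln n\<close> gives Pick's
  theorem on the disc, and a Cayley transform carries it to the half-plane. If the Pick matrix had a
  null vector, then adjoining a further interpolation point \<open>s\<close> would show that \<open>\<phi>\<close> is rational. But
  \<open>\<phi>(x)\<close> approaches its constant coefficient exponentially fast as \<open>x \<longlongrightarrow> \<infinity>\<close>, which forces the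
  null vector to vanish.
\<close>

section \<open>Means of trigonometric polynomials\<close>

text \<open>Cesaro means over integer samples stand in for the mean value along a vertical line. For
  finitely many frequencies and a small enough sampling step they obey the same orthogonality
  relations, and no integral is involved.\<close>

definition has_mean :: "(nat \<Rightarrow> complex) \<Rightarrow> complex \<Rightarrow> bool" where
  "has_mean f L \<longleftrightarrow> (\<lambda>M. (\<Sum>m<M. f m) / of_nat M) \<longlonglongrightarrow> L"

lemma has_mean_cmult: "has_mean f L \<Longrightarrow> has_mean (\<lambda>m. c * f m) (c * L)"
  unfolding has_mean_def sum_distrib_left[symmetric] times_divide_eq_right[symmetric]
  by (intro tendsto_intros)

lemma has_mean_sum:
  assumes "\<And>i. i \<in> I \<Longrightarrow> has_mean (f i) (L i)"
  shows "has_mean (\<lambda>m. \<Sum>i\<in>I. f i m) (\<Sum>i\<in>I. L i)"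
proof -
  have "(\<Sum>m<M. \<Sum>i\<in>I. f i m) / of_nat M = (\<Sum>i\<in>I. (\<Sum>m<M. f i m) / of_nat M)" for M
    by (subst sum.swap) (simp add: sum_divide_distrib)
  then show ?thesis
    using assms unfolding has_mean_def by (auto intro!: tendsto_sum)
qed

lemma has_mean_diff: "has_mean f L \<Longrightarrow> has_mean g L' \<Longrightarrow> has_mean (\<lambda>m. f m - g m) (L - L')"
  unfolding has_mean_def sum_subtractf diff_divide_distrib by (intro tendsto_intros)

lemma has_mean_add: "has_mean f L \<Longrightarrow> has_mean g L' \<Longrightarrow> has_mean (\<lambda>m. f m + g m) (L + L')"
  unfolding has_mean_def sum.distrib add_divide_distrib by (intro tendsto_intros)

lemma has_mean_Re_nonneg:
  assumes "has_mean f L" "\<And>m. Re (f m) \<ge> 0"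
  shows "Re L \<ge> 0"
proof (rule LIMSEQ_le_const)
  show "(\<lambda>M. Re ((\<Sum>m<M. f m) / of_nat M)) \<longlonglongrightarrow> Re L"
    using assms(1) unfolding has_mean_def by (rule tendsto_Re)
  show "\<exists>N. \<forall>M\<ge>N. 0 \<le> Re ((\<Sum>m<M. f m) / of_nat M)"
    by (auto simp: assms(2) intro!: sum_nonneg divide_nonneg_nonneg)
qed

lemma cis_ne_1:
  assumes "\<bar>\<alpha>\<bar> < 2 * pi" "\<alpha> \<noteq> 0"
  shows "cis \<alpha> \<noteq> 1"
proof
  assume "cis \<alpha> = 1"
  then have "cos \<alpha> = 1" by (simp add: complex_eq_iff)
  then obtain n :: int where "\<alpha> = n * (2 * pi)" unfolding cos_one_2pi_int by auto
  with assms show False by (auto simp: abs_mult)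
qed

text \<open>For \<open>\<alpha> \<noteq> 0\<close> the geometric sums stay bounded, so dividing by
  \<open>M\<close> sends them to 0. The restriction to \<open>2 * pi\<close> rules out aliasing,
  where a nonzero frequency looks constant on the integers.\<close>

lemma has_mean_cis:
  assumes "\<bar>\<alpha>\<bar> < 2 * pi"
  shows "has_mean (\<lambda>m. cis (\<alpha> * real m)) (if \<alpha> = 0 then 1 else 0)"
proof (cases "\<alpha> = 0")
  case True
  have "(\<lambda>M. (\<Sum>m<M. 1) / of_nat M :: complex) \<longlonglongrightarrow> 1"
    by (rule tendsto_eventually, rule eventually_sequentiallyI[of 1]) auto
  with True show ?thesis by (simp add: has_mean_def)
next
  case False
  then have ne: "cis \<alpha> \<noteq> 1" using cis_ne_1 assms by blast
  have sum: "(\<Sum>m<M. cis (\<alpha> * real m)) = (cis \<alpha> ^ M - 1) / (cis \<alpha> - 1)" for M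
    using geometric_sum[OF ne, of M] by (simp add: Complex.DeMoivre mult.commute)
  have "(\<lambda>M. (\<Sum>m<M. cis (\<alpha> * real m)) / of_nat M) \<longlonglongrightarrow> 0"
  proof (rule Lim_null_comparison)
    show "\<forall>\<^sub>F M in sequentially. norm ((\<Sum>m<M. cis (\<alpha> * real m)) / of_nat M)
            \<le> (2 / norm (cis \<alpha> - 1)) * (1 / real M)"
    proof (rule always_eventually, rule allI)
      fix M
      have "norm (cis \<alpha> ^ M - 1) \<le> norm (cis \<alpha> ^ M) + norm (1 :: complex)"
        by (rule norm_triangle_ineq4)
      then have "norm (cis \<alpha> ^ M - 1) \<le> 2" by (simp add: norm_power)
      then show "norm ((\<Sum>m<M. cis (\<alpha> * real m)) / of_nat M) \<le> (2 / norm (cis \<alpha> - 1)) * (1 / real M)"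
        unfolding sum by (simp add: norm_divide norm_mult divide_right_mono)
    qed
    show "(\<lambda>M. (2 / norm (cis \<alpha> - 1)) * (1 / real M)) \<longlonglongrightarrow> 0"
      by (rule tendsto_mult_right_zero) (rule lim_1_over_n)
  qed
  with False show ?thesis by (simp add: has_mean_def)
qed

text \<open>Bessel's inequality. Let \<open>Q\<close> have coefficients \<open>q\<close> at the
  frequencies \<open>- l m\<close>, and let \<open>V\<close> and \<open>Y\<close> have coefficients
  \<open>v\<close> and \<open>y\<close> at the frequencies \<open>l k\<close>. Then
  \<open>y n\<close> is the coefficient of \<open>Q * V\<close> at \<open>l n\<close>, so
  \<open>Y\<close> is the part of \<open>Q * V\<close> with frequencies from \<open>K\<close>. Its
  mean square is at most that of \<open>Q * V\<close>, hence at most \<open>C\<close> squared times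
  that of \<open>V\<close>.\<close>

lemma bessel_twisted_convolution:
  fixes q v y :: "'a \<Rightarrow> complex" and l :: "'a \<Rightarrow> real"
  assumes A: "finite A" and K: "finite K" and inj: "inj l"
    and hom: "\<And>m n. l (opr m n) = l m + l n"
    and bound: "\<And>t. norm (\<Sum>m\<in>A. q m * cis (- (l m * t))) \<le> C"
    and y: "\<And>n. y n = (\<Sum>m\<in>A. q m * v (opr m n))"
  shows "(\<Sum>n\<in>K. (norm (y n))\<^sup>2) \<le> C\<^sup>2 * (\<Sum>k\<in>(\<lambda>(m, n). opr m n) ` (A \<times> K). (norm (v k))\<^sup>2)"
proof -
  define B where "B = (\<lambda>(m, n). opr m n) ` (A \<times> K)"
  have B: "finite B" unfolding B_def using A K by auto
  \<comment> \<open>The step \<open>h\<close> is so small that the frequencies occurring below, all at most \<open>3 L\<close> in absolute value,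
    are not aliased by sampling at multiples of \<open>h\<close>.\<close>
  define L where "L = (\<Sum>k\<in>A \<union> K \<union> B. \<bar>l k\<bar>)"
  have L: "\<bar>l k\<bar> \<le> L" if "k \<in> A \<union> K \<union> B" for k
    unfolding L_def by (rule member_le_sum) (use that A K B in auto)
  have L0: "L \<ge> 0" unfolding L_def by (simp add: sum_nonneg)
  define h where "h = 1 / (3 * L + 1)"
  have h0: "h > 0" unfolding h_def using L0 by simp
  have small: "\<bar>x * h\<bar> < 2 * pi" if "\<bar>x\<bar> \<le> 3 * L" for x
  proof -
    have "\<bar>x * h\<bar> \<le> 3 * L * h" using that h0 by (simp add: abs_mult mult_right_mono)
    also have "\<dots> \<le> 1" using L0 by (simp add: h_def)
    also have "1 < 2 * pi" using pi_ge_two by simp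
    finally show ?thesis .
  qed
  have mean: "has_mean (\<lambda>m. cis (x * (h * real m))) (if x = 0 then 1 else 0)" if "\<bar>x\<bar> \<le> 3 * L" for x
    using has_mean_cis[OF small[OF that]] h0 by (simp add: mult.assoc)
  define Q where "Q t = (\<Sum>m\<in>A. q m * cis (- (l m * t)))" for t
  define V where "V t = (\<Sum>k\<in>B. v k * cis (l k * t))" for t
  define Y where "Y t = (\<Sum>n\<in>K. y n * cis (l n * t))" for t
  \<comment> \<open>Parseval for the sampled polynomials: injectivity of \<open>l\<close> leaves
    only the diagonal terms of the double sum.\<close>
  have sq: "has_mean (\<lambda>m. (\<Sum>k\<in>X. f k * cis (l k * (h * real m))) * cnj (\<Sum>k\<in>X. f k * cis (l k * (h * real m))))
             (of_real (\<Sum>k\<in>X. (norm (f k))\<^sup>2))" if X: "finite X" "X \<subseteq> A \<union> K \<union> B" for X f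
  proof -
    have "(\<Sum>k\<in>X. f k * cis (l k * (h * real m))) * cnj (\<Sum>k\<in>X. f k * cis (l k * (h * real m)))
        = (\<Sum>k\<in>X. \<Sum>j\<in>X. f k * cnj (f j) * cis ((l k - l j) * (h * real m)))" for m
      by (simp add: sum_product cis_cnj left_diff_distrib cis_divide [symmetric] 
           flip: cis_inverse) (simp add: field_simps)
    moreover have "has_mean (\<lambda>m. \<Sum>k\<in>X. \<Sum>j\<in>X. f k * cnj (f j) * cis ((l k - l j) * (h * real m)))
        (\<Sum>k\<in>X. \<Sum>j\<in>X. f k * cnj (f j) * (if l k - l j = 0 then 1 else 0))"
      apply (intro has_mean_sum has_mean_cmult mean)
      subgoal for k j using L[of k] L[of j] L0 subsetD[OF X(2), of k] subsetD[OF X(2), of j] by linarith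
      done
    moreover have "(\<Sum>k\<in>X. \<Sum>j\<in>X. f k * cnj (f j) * (if l k - l j = 0 then 1 else 0))
        = of_real (\<Sum>k\<in>X. (norm (f k))\<^sup>2)"
      using X by (simp add: inj_eq[OF inj] if_distrib[of "(*) _"] complex_norm_square
          del: of_real_power cong: if_cong)
    ultimately show ?thesis by simp
  qed
  \<comment> \<open>A triple product survives the mean only if \<open>l k = l m + l n\<close>, that
    is \<open>k = opr m n\<close>. Such \<open>k\<close> lie in \<open>B\<close>, so the inner sums
    reproduce exactly \<open>y n\<close>.\<close>
  have cross: "has_mean (\<lambda>m. Q (h * real m) * V (h * real m) * cnj (Y (h * real m)))
      (of_real (\<Sum>n\<in>K. (norm (y n))\<^sup>2))"
  proof -
    have cs: "cis (- a) * cis b * cis (- c) = cis (b - a - c)" for a b c :: real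
      by (simp add: cis_mult)
    have "Q t * V t * cnj (Y t)
        = (\<Sum>n\<in>K. \<Sum>m\<in>A. \<Sum>k\<in>B. cnj (y n) * q m * v k * cis ((l k - l m - l n) * t))" for t
    proof -
      have "Q t * V t * cnj (Y t) = cnj (Y t) * (Q t * V t)" by simp
      also have "\<dots> = (\<Sum>n\<in>K. \<Sum>m\<in>A. \<Sum>k\<in>B. (cnj (y n) * cis (- (l n * t))) * ((q m * cis (- (l m * t))) * (v k * cis (l k * t))))"
        unfolding Y_def Q_def V_def cnj_sum complex_cnj_mult cis_cnj sum_product
        unfolding sum_distrib_left by simp
      also have "\<dots> = (\<Sum>n\<in>K. \<Sum>m\<in>A. \<Sum>k\<in>B. cnj (y n) * q m * v k * (cis (- (l m * t)) * cis (l k * t) * cis (- (l n * t))))"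
        by (simp add: mult_ac)
      finally show ?thesis by (simp only: cs left_diff_distrib)
    qed
    moreover have "has_mean (\<lambda>j. \<Sum>n\<in>K. \<Sum>m\<in>A. \<Sum>k\<in>B. cnj (y n) * q m * v k * cis ((l k - l m - l n) * (h * real j)))
        (\<Sum>n\<in>K. \<Sum>m\<in>A. \<Sum>k\<in>B. cnj (y n) * q m * v k * (if l k - l m - l n = 0 then 1 else 0))"
      apply (intro has_mean_sum has_mean_cmult mean)
      subgoal for n m k using L[of k] L[of m] L[of n] L0 by (simp; linarith)
      done
    moreover have "(\<Sum>n\<in>K. \<Sum>m\<in>A. \<Sum>k\<in>B. cnj (y n) * q m * v k * (if l k - l m - l n = 0 then 1 else 0))
        = of_real (\<Sum>n\<in>K. (norm (y n))\<^sup>2)"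
    proof -
      have eq: "l k - l m - l n = 0 \<longleftrightarrow> k = opr m n" for k m n
        using inj_eq[OF inj, of k "opr m n"] hom[of m n] by auto
      have "(\<Sum>k\<in>B. cnj (y n) * q m * v k * (if l k - l m - l n = 0 then 1 else 0))
          = cnj (y n) * (q m * v (opr m n))" if "n \<in> K" "m \<in> A" for n m
      proof -
        have "opr m n \<in> B" using that by (auto simp: B_def)
        then show ?thesis using B unfolding eq
          by (simp add: if_distrib[of "(*) _"] cong: if_cong)
      qed
      then have "(\<Sum>n\<in>K. \<Sum>m\<in>A. \<Sum>k\<in>B. cnj (y n) * q m * v k * (if l k - l m - l n = 0 then 1 else 0))
          = (\<Sum>n\<in>K. \<Sum>m\<in>A. cnj (y n) * (q m * v (opr m n)))"
        by (intro sum.cong refl) auto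
      also have "\<dots> = (\<Sum>n\<in>K. cnj (y n) * y n)" by (simp add: y sum_distrib_left)
      finally show ?thesis by (simp add: complex_norm_square mult.commute del: of_real_power)
    qed
    ultimately show ?thesis by simp
  qed
  have VV: "has_mean (\<lambda>m. V (h * real m) * cnj (V (h * real m))) (of_real (\<Sum>k\<in>B. (norm (v k))\<^sup>2))"
    unfolding V_def by (rule sq) (use B in auto)
  have YY: "has_mean (\<lambda>m. Y (h * real m) * cnj (Y (h * real m))) (of_real (\<Sum>k\<in>K. (norm (y k))\<^sup>2))"
    unfolding Y_def by (rule sq) (use K in auto)
  \<comment> \<open>The averaged quantity dominates the square of
    \<open>norm (Q t * V t - Y t)\<close>, because \<open>norm (Q t) \<le> C\<close>. The cross term
    enters with factor 2 and the square of \<open>Y\<close> with factor 1, so one copy of the sum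
    over \<open>y\<close> remains to be bounded.\<close>
  have "0 \<le> Re (of_real (C\<^sup>2) * of_real (\<Sum>k\<in>B. (norm (v k))\<^sup>2) - 2 * of_real (\<Sum>n\<in>K. (norm (y n))\<^sup>2)
                 + of_real (\<Sum>k\<in>K. (norm (y k))\<^sup>2))"
  proof (rule has_mean_Re_nonneg)
    show "has_mean (\<lambda>m. of_real (C\<^sup>2) * (V (h * real m) * cnj (V (h * real m)))
        - 2 * (Q (h * real m) * V (h * real m) * cnj (Y (h * real m)))
        + Y (h * real m) * cnj (Y (h * real m)))
      (of_real (C\<^sup>2) * of_real (\<Sum>k\<in>B. (norm (v k))\<^sup>2) - 2 * of_real (\<Sum>n\<in>K. (norm (y n))\<^sup>2)
                 + of_real (\<Sum>k\<in>K. (norm (y k))\<^sup>2))"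
      by (intro has_mean_add has_mean_diff has_mean_cmult VV YY cross)
    fix m
    define t where "t = h * real m"
    have "norm (Q t) \<le> C" using bound by (simp add: Q_def)
    then have "(norm (Q t * V t))\<^sup>2 \<le> (C * norm (V t))\<^sup>2"
      by (simp add: norm_mult mult_right_mono power_mono)
    moreover have "(norm (Q t * V t - Y t))\<^sup>2
        = (norm (Q t * V t))\<^sup>2 - 2 * Re (Q t * V t * cnj (Y t)) + (norm (Y t))\<^sup>2"
      unfolding cmod_power2 by (simp add: power2_eq_square algebra_simps)
    moreover have "0 \<le> (norm (Q t * V t - Y t))\<^sup>2" by simp
    ultimately have "0 \<le> C\<^sup>2 * (norm (V t))\<^sup>2 - 2 * Re (Q t * V t * cnj (Y t)) + (norm (Y t))\<^sup>2"
      by (simp add: power_mult_distrib)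
    then have "0 \<le> Re (of_real (C\<^sup>2) * (V t * cnj (V t)) - 2 * (Q t * V t * cnj (Y t)) + Y t * cnj (Y t))"
      by (simp add: complex_norm_square [symmetric] del: of_real_power)
    then show "0 \<le> Re (of_real (C\<^sup>2) * (V (h * real m) * cnj (V (h * real m)))
        - 2 * (Q (h * real m) * V (h * real m) * cnj (Y (h * real m)))
        + Y (h * real m) * cnj (Y (h * real m)))"
      by (simp add: t_def)
  qed
  then have "(\<Sum>n\<in>K. (norm (y n))\<^sup>2) \<le> C\<^sup>2 * (\<Sum>k\<in>B. (norm (v k))\<^sup>2)"
    by (simp add: Re_divide flip: of_real_mult)
  then show ?thesis by (simp add: B_def)
qed

section \<open>Positive semi-definite kernels from contractive multipliers\<close>

text \<open>Membership in \<open>\<real>\<^sub>\<ge>\<^sub>0\<close> combines reality and sign of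
  the form in one closed condition, which passes to limits. Working with functions of indices keeps
  matrix types out of the analysis.\<close>

definition psd_kernel :: "nat \<Rightarrow> (nat \<Rightarrow> nat \<Rightarrow> complex) \<Rightarrow> bool" where
  "psd_kernel n K \<longleftrightarrow> (\<forall>c. (\<Sum>i<n. \<Sum>j<n. cnj (c i) * K i j * c j) \<in> \<real>\<^sub>\<ge>\<^sub>0)"

lemma psd_kernel_cong:
  assumes "\<And>i j. i < n \<Longrightarrow> j < n \<Longrightarrow> K i j = K' i j"
  shows "psd_kernel n K \<longleftrightarrow> psd_kernel n K'"
proof -
  have "(\<Sum>i<n. \<Sum>j<n. cnj (c i) * K i j * c j) = (\<Sum>i<n. \<Sum>j<n. cnj (c i) * K' i j * c j)" for c
    by (intro sum.cong refl) (auto simp: assms)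
  then show ?thesis by (simp add: psd_kernel_def)
qed

lemma psd_kernel_congruence:
  assumes "psd_kernel n K"
  shows "psd_kernel n (\<lambda>i j. cnj (d i) * K i j * d j)"
  unfolding psd_kernel_def
proof
  fix c :: "nat \<Rightarrow> complex"
  have "(\<Sum>i<n. \<Sum>j<n. cnj (d i * c i) * K i j * (d j * c j)) \<in> \<real>\<^sub>\<ge>\<^sub>0"
    using assms[unfolded psd_kernel_def, rule_format, of "\<lambda>i. d i * c i"] .
  then show "(\<Sum>i<n. \<Sum>j<n. cnj (c i) * (cnj (d i) * K i j * d j) * c j) \<in> \<real>\<^sub>\<ge>\<^sub>0"
    by (simp add: mult_ac)
qed

lemma psd_kernel_limit:
  assumes "\<And>k. psd_kernel n (K k)"
    and lim: "\<And>i j. i < n \<Longrightarrow> j < n \<Longrightarrow> (\<lambda>k. K k i j) \<longlonglongrightarrow> L i j"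
  shows "psd_kernel n L"
  unfolding psd_kernel_def
proof
  fix c :: "nat \<Rightarrow> complex"
  show "(\<Sum>i<n. \<Sum>j<n. cnj (c i) * L i j * c j) \<in> \<real>\<^sub>\<ge>\<^sub>0"
  proof (rule closed_sequentially[OF closed_nonneg_Reals_complex])
    show "(\<Sum>i<n. \<Sum>j<n. cnj (c i) * K k i j * c j) \<in> \<real>\<^sub>\<ge>\<^sub>0" for k
      using assms(1)[of k] by (simp add: psd_kernel_def)
    show "(\<lambda>k. \<Sum>i<n. \<Sum>j<n. cnj (c i) * K k i j * c j) \<longlonglongrightarrow> (\<Sum>i<n. \<Sum>j<n. cnj (c i) * L i j * c j)"
      by (intro tendsto_intros lim) auto
  qed
qed

text \<open>The inner series are the Gram matrix of the square-summable sequences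
  \<open>\<psi> j\<close>, so its form at \<open>c\<close> is the squared norm of their combination.
  The Gram entries converge because a product is dominated by the sum of the two squares.\<close>

lemma sums_hermitian_form:
  fixes \<psi> :: "nat \<Rightarrow> nat \<Rightarrow> complex"
  assumes sq: "\<And>j. j < N \<Longrightarrow> summable (\<lambda>n. (norm (\<psi> j n))\<^sup>2)"
  shows "(\<lambda>n. (norm (\<Sum>j<N. c j * \<psi> j n))\<^sup>2) sums
           Re (\<Sum>i<N. \<Sum>j<N. cnj (c i) * (\<Sum>n. cnj (\<psi> i n) * \<psi> j n) * c j)" (is ?A)
    and "Im (\<Sum>i<N. \<Sum>j<N. cnj (c i) * (\<Sum>n. cnj (\<psi> i n) * \<psi> j n) * c j) = 0" (is ?B)
proof -
  have summ: "summable (\<lambda>n. cnj (\<psi> i n) * \<psi> j n)" if "i < N" "j < N" for i j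
  proof (rule summable_comparison_test')
    show "summable (\<lambda>n. (norm (\<psi> i n))\<^sup>2 + (norm (\<psi> j n))\<^sup>2)"
      by (intro summable_add sq that)
    show "norm (cnj (\<psi> i n) * \<psi> j n) \<le> (norm (\<psi> i n))\<^sup>2 + (norm (\<psi> j n))\<^sup>2" for n
    proof -
      have "2 * norm (\<psi> i n) * norm (\<psi> j n) \<le> (norm (\<psi> i n))\<^sup>2 + (norm (\<psi> j n))\<^sup>2"
        by (rule sum_squares_bound)
      moreover have "0 \<le> norm (\<psi> i n) * norm (\<psi> j n)" by simp
      ultimately show ?thesis unfolding norm_mult complex_mod_cnj by linarith
    qed
  qed
  have "(\<lambda>n. \<Sum>i<N. \<Sum>j<N. cnj (c i) * (cnj (\<psi> i n) * \<psi> j n) * c j) sums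
      (\<Sum>i<N. \<Sum>j<N. cnj (c i) * (\<Sum>n. cnj (\<psi> i n) * \<psi> j n) * c j)"
    by (intro sums_sum sums_mult sums_mult2 summable_sums summ) auto
  moreover have "(\<Sum>i<N. \<Sum>j<N. cnj (c i) * (cnj (\<psi> i n) * \<psi> j n) * c j)
      = of_real ((norm (\<Sum>j<N. c j * \<psi> j n))\<^sup>2)" for n
  proof -
    have "of_real ((norm (\<Sum>j<N. c j * \<psi> j n))\<^sup>2) = cnj (\<Sum>j<N. c j * \<psi> j n) * (\<Sum>j<N. c j * \<psi> j n)"
      by (subst complex_norm_square) (rule mult.commute)
    then show ?thesis unfolding cnj_sum sum_product complex_cnj_mult by (simp add: mult_ac del: of_real_power)
  qed
  ultimately have *: "(\<lambda>n. of_real ((norm (\<Sum>j<N. c j * \<psi> j n))\<^sup>2)) sums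
      (\<Sum>i<N. \<Sum>j<N. cnj (c i) * (\<Sum>n. cnj (\<psi> i n) * \<psi> j n) * c j)" by (simp del: of_real_power)
  from sums_Re[OF *] show ?A by (simp del: of_real_power)
  from sums_Im[OF *] have "(\<lambda>n::nat. 0::real) sums Im (\<Sum>i<N. \<Sum>j<N. cnj (c i) * (\<Sum>n. cnj (\<psi> i n) * \<psi> j n) * c j)"
    by (simp del: of_real_power)
  then show ?B using sums_unique2[OF _ sums_zero] by blast
qed

text \<open>
  The operation \<open>opr\<close> is addition for power series; for Dirichlet series, whose \<open>n\<close>th term belongs to
  the integer \<open>n + 1\<close>, it is \<open>Suc m * Suc n - 1\<close>.
\<close>

lemma psd_kernel_multiplier:
  fixes \<psi> :: "nat \<Rightarrow> nat \<Rightarrow> complex" and q :: "nat \<Rightarrow> complex" and l :: "nat \<Rightarrow> real"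
  assumes inj: "inj l" and hom: "\<And>m n. l (opr m n) = l m + l n"
    and mult: "\<And>j m n. j < N \<Longrightarrow> \<psi> j (opr m n) = \<psi> j m * \<psi> j n"
    and bdd: "\<And>j m. j < N \<Longrightarrow> norm (\<psi> j m) \<le> 1"
    and sq: "\<And>j. j < N \<Longrightarrow> summable (\<lambda>n. (norm (\<psi> j n))\<^sup>2)"
    and q: "summable (\<lambda>m. norm (q m))"
    and bound: "\<And>t. norm (\<Sum>m. q m * cis (- (l m * t))) \<le> 1"
  shows "psd_kernel N (\<lambda>i j. (1 - cnj (\<Sum>m. q m * \<psi> i m) * (\<Sum>m. q m * \<psi> j m)) *
                              (\<Sum>n. cnj (\<psi> i n) * \<psi> j n))"
  unfolding psd_kernel_def
proof
  fix c :: "nat \<Rightarrow> complex"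
  define W where "W j = (\<Sum>m. q m * \<psi> j m)" for j
  define WM where "WM M j = (\<Sum>m<M. q m * \<psi> j m)" for M j
  define v where "v k = (\<Sum>j<N. c j * \<psi> j k)" for k
  define S where "S i j = (\<Sum>n. cnj (\<psi> i n) * \<psi> j n)" for i j
  define \<epsilon> where "\<epsilon> M = (\<Sum>m. norm (q (m + M)))" for M
  have WM: "(\<lambda>M. WM M j) \<longlonglongrightarrow> W j" if "j < N" for j
  proof -
    have "summable (\<lambda>m. q m * \<psi> j m)"
      by (rule summable_comparison_test'[OF q])
         (use bdd[OF that] in \<open>auto simp: norm_mult intro!: mult_left_le\<close>)
    then show ?thesis unfolding W_def WM_def by (rule summable_LIMSEQ)
  qed
  note sv = sums_hermitian_form(1)[where \<psi>=\<psi> and c=c and N=N, OF sq, folded v_def S_def]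
  have sv': "summable (\<lambda>k. (norm (v k))\<^sup>2)" using sv by (rule sums_summable)
  have eps: "\<epsilon> \<longlonglongrightarrow> 0" unfolding \<epsilon>_def by (rule suminf_exist_split2[OF q])
  \<comment> \<open>The contraction bound is known only for the full series. Cutting it off at
    \<open>M\<close> costs at most the tail \<open>\<epsilon> M\<close>, uniformly in
    \<open>t\<close>, and makes the finite inequality applicable.\<close>
  have trunc: "norm (\<Sum>m<M. q m * cis (- (l m * t))) \<le> 1 + \<epsilon> M" for M t
  proof -
    have s: "summable (\<lambda>m. norm (q m * cis (- (l m * t))))" using q by (simp add: norm_mult)
    then have s': "summable (\<lambda>m. q m * cis (- (l m * t)))" by (rule summable_norm_cancel)
    have "norm (\<Sum>m. q (m + M) * cis (- (l (m + M) * t))) \<le> (\<Sum>m. norm (q (m + M) * cis (- (l (m + M) * t))))"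
      by (rule summable_norm) (use summable_ignore_initial_segment[OF s, of M] in simp)
    then have "norm (\<Sum>m. q (m + M) * cis (- (l (m + M) * t))) \<le> \<epsilon> M"
      by (simp add: norm_mult \<epsilon>_def)
    moreover have "(\<Sum>m<M. q m * cis (- (l m * t)))
       = (\<Sum>m. q m * cis (- (l m * t))) - (\<Sum>m. q (m + M) * cis (- (l (m + M) * t)))"
      using suminf_split_initial_segment[OF s', of M] by simp
    ultimately show ?thesis
      using norm_triangle_ineq4[of "\<Sum>m. q m * cis (- (l m * t))" "\<Sum>m. q (m + M) * cis (- (l (m + M) * t))"]
        bound[of t] by simp
  qed
  have fin: "(\<Sum>n<K. (norm (\<Sum>j<N. c j * WM M j * \<psi> j n))\<^sup>2) \<le> (1 + \<epsilon> M)\<^sup>2 * (\<Sum>k. (norm (v k))\<^sup>2)" for K M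
  proof -
    have "(\<Sum>n<K. (norm (\<Sum>j<N. c j * WM M j * \<psi> j n))\<^sup>2)
       \<le> (1 + \<epsilon> M)\<^sup>2 * (\<Sum>k\<in>(\<lambda>(m, n). opr m n) ` ({..<M} \<times> {..<K}). (norm (v k))\<^sup>2)"
    proof (rule bessel_twisted_convolution[OF _ _ inj hom])
      show "norm (\<Sum>m<M. q m * cis (- (l m * t))) \<le> 1 + \<epsilon> M" for t by (rule trunc)
      fix n
      \<comment> \<open>Multiplicativity makes every \<open>\<psi> j\<close> an eigenvector of the
        transposed multiplication by the truncated \<open>q\<close>, with eigenvalue
        \<open>WM M j\<close>.\<close>
      have "(\<Sum>m<M. q m * v (opr m n)) = (\<Sum>m<M. \<Sum>j<N. c j * (q m * \<psi> j m) * \<psi> j n)"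
        by (simp add: v_def mult sum_distrib_left mult_ac)
      also have "\<dots> = (\<Sum>j<N. \<Sum>m<M. c j * (q m * \<psi> j m) * \<psi> j n)" by (rule sum.swap)
      also have "\<dots> = (\<Sum>j<N. c j * WM M j * \<psi> j n)"
        by (simp add: WM_def sum_distrib_left sum_distrib_right)
      finally show "(\<Sum>j<N. c j * WM M j * \<psi> j n) = (\<Sum>m<M. q m * v (opr m n))" by simp
    qed auto
    also have "\<dots> \<le> (1 + \<epsilon> M)\<^sup>2 * (\<Sum>k. (norm (v k))\<^sup>2)"
      by (intro mult_left_mono sum_le_suminf sv') auto
    finally show ?thesis .
  qed
  \<comment> \<open>The truncation \<open>M\<close> goes to infinity first, while \<open>K\<close>
    keeps the left side a finite sum. The bound is then uniform in \<open>K\<close>, so it passes to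
    the infinite sum.\<close>
  have "(\<Sum>n<K. (norm (\<Sum>j<N. c j * W j * \<psi> j n))\<^sup>2) \<le> (1 + 0)\<^sup>2 * (\<Sum>k. (norm (v k))\<^sup>2)" for K
  proof (rule LIMSEQ_le)
    show "(\<lambda>M. (1 + \<epsilon> M)\<^sup>2 * (\<Sum>k. (norm (v k))\<^sup>2)) \<longlonglongrightarrow> (1 + 0)\<^sup>2 * (\<Sum>k. (norm (v k))\<^sup>2)"
      by (intro tendsto_intros eps)
    show "(\<lambda>M. \<Sum>n<K. (norm (\<Sum>j<N. c j * WM M j * \<psi> j n))\<^sup>2) \<longlonglongrightarrow> (\<Sum>n<K. (norm (\<Sum>j<N. c j * W j * \<psi> j n))\<^sup>2)"
      by (intro tendsto_intros WM) auto
  qed (use fin in blast)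
  then have le: "(\<Sum>n<K. (norm (\<Sum>j<N. c j * W j * \<psi> j n))\<^sup>2) \<le> (\<Sum>k. (norm (v k))\<^sup>2)" for K by simp
  note sW = sums_hermitian_form(1)[where \<psi>=\<psi> and c="\<lambda>j. c j * W j" and N=N, OF sq, folded S_def]
  note iW = sums_hermitian_form(2)[where \<psi>=\<psi> and c="\<lambda>j. c j * W j" and N=N, OF sq, folded S_def]
  note iv = sums_hermitian_form(2)[where \<psi>=\<psi> and c=c and N=N, OF sq, folded S_def]
  \<comment> \<open>\<open>T1\<close> is the squared norm of the combination \<open>v\<close>, and
    \<open>T2\<close> that of its image with coefficients \<open>c j * W j\<close>. The form to be
    shown nonnegative is their difference.\<close>
  define T1 where "T1 = (\<Sum>i<N. \<Sum>j<N. cnj (c i) * S i j * c j)"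
  define T2 where "T2 = (\<Sum>i<N. \<Sum>j<N. cnj (c i * W i) * S i j * (c j * W j))"
  have "Re T2 \<le> Re T1"
  proof -
    have "Re T2 = (\<Sum>n. (norm (\<Sum>j<N. c j * W j * \<psi> j n))\<^sup>2)"
      using sums_unique[OF sW] by (simp add: T2_def)
    also have "\<dots> \<le> (\<Sum>k. (norm (v k))\<^sup>2)"
      by (rule suminf_le_const[OF sums_summable[OF sW] le])
    also have "\<dots> = Re T1" using sums_unique[OF sv] by (simp add: T1_def)
    finally show ?thesis .
  qed
  moreover have "Im T1 = 0" using iv by (simp add: T1_def)
  moreover have "Im T2 = 0" using iW by (simp add: T2_def)
  moreover have "(\<Sum>i<N. \<Sum>j<N. cnj (c i) * ((1 - cnj (W i) * W j) * S i j) * c j) = T1 - T2"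
    unfolding T1_def T2_def sum_subtractf[symmetric]
    by (intro sum.cong refl) (simp add: algebra_simps)
  ultimately show "(\<Sum>i<N. \<Sum>j<N. cnj (c i) * ((1 - cnj (\<Sum>m. q m * \<psi> i m) * (\<Sum>m. q m * \<psi> j m)) * (\<Sum>n. cnj (\<psi> i n) * \<psi> j n)) * c j) \<in> \<real>\<^sub>\<ge>\<^sub>0"
    by (simp add: W_def[symmetric] S_def[symmetric] complex_nonneg_Reals_iff)
qed

section \<open>Pick's theorem on the disc and the half-plane\<close>

text \<open>The multiplier lemma needs absolutely summable coefficients, which \<open>f\<close> may
  fail to have but its dilates \<open>f (r k * z)\<close> do have. With
  \<open>\<psi> j n = z j ^ n\<close> the Gram matrix is the Szego kernel, and the result for
  \<open>f\<close> follows as \<open>r k\<close> tends to 1.\<close>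

lemma psd_kernel_disc:
  assumes hol: "f holomorphic_on ball 0 1" and le1: "\<And>z. z \<in> ball 0 1 \<Longrightarrow> norm (f z) \<le> 1"
    and z: "\<And>j. j < N \<Longrightarrow> norm (z j) < 1"
  shows "psd_kernel N (\<lambda>i j. (1 - cnj (f (z i)) * f (z j)) / (1 - cnj (z i) * z j))"
proof -
  define a where "a m = (deriv ^^ m) f 0 / fact m" for m
  have a: "(\<lambda>m. a m * w ^ m) sums f w" if "norm w < 1" for w
    using holomorphic_power_series[OF hol, of w] that by (simp add: a_def)
  \<comment> \<open>The summand 2 keeps \<open>r 0\<close> away from 0, so that all radii lie
    strictly between 0 and 1.\<close>
  define r where "r k = 1 - 1 / (real k + 2)" for k
  have r: "0 < r k" "r k < 1" for k by (auto simp: r_def field_simps)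
  have dil: "psd_kernel N (\<lambda>i j. (1 - cnj (f (r k * z i)) * f (r k * z j)) / (1 - cnj (z i) * z j))" for k
  proof -
    define q where "q m = a m * of_real (r k) ^ m" for m
    have q: "(\<lambda>m. q m * w ^ m) sums f (r k * w)" if "norm w \<le> 1" for w :: complex
    proof -
      have "norm (of_real (r k) * w) < 1"
        using r[of k] le_less_trans[OF mult_left_le[OF that, of "r k"]] by (simp add: norm_mult)
      from a[OF this] show ?thesis by (simp add: q_def power_mult_distrib mult_ac)
    qed
    have "psd_kernel N (\<lambda>i j. (1 - cnj (\<Sum>m. q m * z i ^ m) * (\<Sum>m. q m * z j ^ m)) * (\<Sum>n. cnj (z i ^ n) * z j ^ n))"
    proof (rule psd_kernel_multiplier[where l = real and opr = "(+)"])
      show "inj real" by (simp add: inj_on_def)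
      show "norm (z j ^ m) \<le> 1" if "j < N" for j m
        using z[OF that] by (simp add: norm_power power_le_one)
      show "summable (\<lambda>n. (norm (z j ^ n))\<^sup>2)" if "j < N" for j
      proof -
        have "(norm (z j ^ n))\<^sup>2 = ((norm (z j))\<^sup>2) ^ n" for n
          by (simp add: norm_power mult.commute flip: power_mult)
        moreover have "(norm (z j))\<^sup>2 < 1" using z[OF that] by (simp add: power_less_one_iff)
        ultimately show ?thesis by (simp add: summable_geometric)
      qed
      show "summable (\<lambda>m. norm (q m))"
        unfolding q_def
      proof (rule powser_insidea)
        \<comment> \<open>The midpoint of \<open>r k\<close> and 1 is still inside the disc of
          convergence, so convergence there gives absolute convergence at the smaller radius
          \<open>r k\<close>.\<close>
        show "summable (\<lambda>n. a n * (of_real ((1 + r k) / 2)) ^ n)"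
          by (rule sums_summable[OF a], simp only: norm_of_real) (use r[of k] in simp)
        show "norm (complex_of_real (r k)) < norm (complex_of_real ((1 + r k) / 2))"
          using r[of k] by (simp only: norm_of_real) simp
      qed
      show "norm (\<Sum>m. q m * cis (- (real m * t))) \<le> 1" for t
      proof -
        have "cis (- (real m * t)) = cis (- t) ^ m" for m by (simp add: Complex.DeMoivre)
        then have "(\<Sum>m. q m * cis (- (real m * t))) = f (r k * cis (- t))"
          using sums_unique[OF q[of "cis (- t)"]] by simp
        then show ?thesis using le1[of "r k * cis (- t)"] r[of k] by (simp add: norm_mult)
      qed
    qed (auto simp: power_add)
    then show ?thesis
    proof (rule psd_kernel_cong[THEN iffD1, rotated])
      fix i j assume ij: "i < N" "j < N"
      have "norm (cnj (z i) * z j) < 1"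
        using z[OF ij(1)] z[OF ij(2)] mult_strict_mono[of "norm (z i)" 1 "norm (z j)" 1] 
        by (simp add: norm_mult)
      then have "(\<Sum>n. cnj (z i ^ n) * z j ^ n) = 1 / (1 - cnj (z i) * z j)"
        using suminf_geometric[of "cnj (z i) * z j"] by (simp add: power_mult_distrib)
      moreover have "(\<Sum>m. q m * z i ^ m) = f (r k * z i)" if "i < N" for i
        using sums_unique[OF q[of "z i"]] z[OF that] by simp
      ultimately show "(1 - cnj (\<Sum>m. q m * z i ^ m) * (\<Sum>m. q m * z j ^ m)) * (\<Sum>n. cnj (z i ^ n) * z j ^ n)
         = (1 - cnj (f (r k * z i)) * f (r k * z j)) / (1 - cnj (z i) * z j)"
        using ij by simp
    qed
  qed
  have lim: "(\<lambda>k. f (r k * z j)) \<longlonglongrightarrow> f (z j)" if "j < N" for j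
  proof (rule continuous_on_tendsto_compose[OF holomorphic_on_imp_continuous_on[OF hol]])
    have "(\<lambda>k. 1 / real (k + 2)) \<longlonglongrightarrow> 0"
      by (rule LIMSEQ_ignore_initial_segment[OF lim_1_over_n])
    then have "r \<longlonglongrightarrow> 1 - 0" unfolding r_def by (intro tendsto_intros) (simp add: add.commute)
    then have "(\<lambda>k. complex_of_real (r k) * z j) \<longlonglongrightarrow> of_real (1 - 0) * z j" by (intro tendsto_intros)
    then show "(\<lambda>k. complex_of_real (r k) * z j) \<longlonglongrightarrow> z j" by simp
    show "z j \<in> ball 0 1" using z[OF that] by simp
    have "r k * norm (z j) < 1" for k
      using r[of k] z[OF that] mult_strict_mono[of "r k" 1 "norm (z j)" 1] by simp
    then show "\<forall>\<^sub>F k in sequentially. complex_of_real (r k) * z j \<in> ball 0 1"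
      using r by (simp add: norm_mult less_imp_le)
  qed
  show ?thesis
  proof (rule psd_kernel_limit[OF dil])
    fix i j assume ij: "i < N" "j < N"
    have "norm (cnj (z i) * z j) < 1"
      using z[OF ij(1)] z[OF ij(2)] mult_strict_mono[of "norm (z i)" 1 "norm (z j)" 1] 
      by (simp add: norm_mult)
    then have "cnj (z i) * z j \<noteq> 1" by auto
    then show "(\<lambda>k. (1 - cnj (f (r k * z i)) * f (r k * z j)) / (1 - cnj (z i) * z j))
        \<longlonglongrightarrow> (1 - cnj (f (z i)) * f (z j)) / (1 - cnj (z i) * z j)"
      by (intro tendsto_intros lim ij) simp
  qed
qed

lemma norm_Cayley_less_1:
  assumes "Re s > 0"
  shows "norm ((1 - s) / (1 + s)) < 1"
proof -
  have "(norm (1 - s))\<^sup>2 < (norm (1 + s))\<^sup>2"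
    using assms unfolding cmod_power2 by (simp add: power2_eq_square algebra_simps)
  then have "norm (1 - s) < norm (1 + s)" by (rule power_less_imp_less_base) simp
  moreover from this have "1 + s \<noteq> 0" by auto
  ultimately show ?thesis by (simp add: norm_divide)
qed

lemma Re_Cayley_pos:
  assumes "norm z < 1"
  shows "Re ((1 - z) / (1 + z)) > 0"
proof -
  have "Re ((1 - z) / (1 + z)) = (1 - (norm z)\<^sup>2) / (norm (1 + z))\<^sup>2"
    unfolding Re_divide cmod_power2 by (simp add: power2_eq_square algebra_simps)
  moreover have "1 + z \<noteq> 0"
  proof
    assume "1 + z = 0"
    then have "z = -1" by (simp add: add_eq_0_iff)
    with assms show False by simp
  qed
  moreover have "(norm z)\<^sup>2 < 1" using assms by (simp add: power_less_one_iff)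
  ultimately show ?thesis by simp
qed

text \<open>The Cayley map \<open>(1 - z) / (1 + z)\<close> is its own inverse and exchanges disc
  and half-plane. It turns the Szego kernel into \<open>1 / (cnj (lam i) + lam j)\<close> up to a
  factor of product form, which a diagonal congruence removes.\<close>

lemma psd_kernel_halfplane:
  assumes \<phi>: "Hinf_unit_ball \<phi>" and lam: "\<And>j. j < N \<Longrightarrow> Re (lam j) > 0"
  shows "psd_kernel N (\<lambda>i j. (1 - cnj (\<phi> (lam i)) * \<phi> (lam j)) / (cnj (lam i) + lam j))"
proof -
  define f where "f z = \<phi> ((1 - z) / (1 + z))" for z
  define z where "z j = (1 - lam j) / (1 + lam j)" for j
  have ne: "1 + lam j \<noteq> 0" if "j < N" for j
    using lam[OF that] by (auto simp: complex_eq_iff)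
  have fz: "f (z j) = \<phi> (lam j)" if "j < N" for j
  proof -
    have "1 + z j = 2 / (1 + lam j)" "1 - z j = 2 * lam j / (1 + lam j)"
      using ne[OF that] by (auto simp: z_def field_simps)
    then show ?thesis using ne[OF that] by (simp add: f_def)
  qed
  have Cayley: "(1 - w) / (1 + w) \<in> halfplane 0" if "w \<in> ball 0 1" for w
    using Re_Cayley_pos[of w] that by (simp add: halfplane_def)
  have "psd_kernel N (\<lambda>i j. (1 - cnj (f (z i)) * f (z j)) / (1 - cnj (z i) * z j))"
  proof (rule psd_kernel_disc)
    have "1 + w \<noteq> 0" if "w \<in> ball 0 1" for w :: complex
      using that by (auto simp: add_eq_0_iff)
    then have "(\<lambda>z. (1 - z) / (1 + z)) holomorphic_on ball 0 1"
      by (intro holomorphic_intros) auto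
    then have "\<phi> \<circ> (\<lambda>z. (1 - z) / (1 + z)) holomorphic_on ball 0 1"
      by (rule holomorphic_on_compose_gen[where t = "halfplane 0"])
         (use \<phi> Cayley in \<open>auto simp: Hinf_unit_ball_def\<close>)
    then show "f holomorphic_on ball 0 1" by (simp add: f_def[abs_def] o_def)
    show "norm (f w) \<le> 1" if "w \<in> ball 0 1" for w
      using \<phi> Cayley[OF that] by (simp add: Hinf_unit_ball_def f_def)
    show "norm (z j) < 1" if "j < N" for j
      unfolding z_def by (rule norm_Cayley_less_1[OF lam[OF that]])
  qed
  \<comment> \<open>\<open>1 - cnj (z i) * z j\<close> equals 2 times
    \<open>cnj (lam i) + lam j\<close> over \<open>(1 + cnj (lam i)) * (1 + lam j)\<close>. Each
    side of the congruence supplies one linear factor and a square root of that 2.\<close>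
  from psd_kernel_congruence[OF this, of "\<lambda>j. sqrt 2 / (1 + lam j)"]
  show ?thesis
  proof (rule psd_kernel_cong[THEN iffD1, rotated])
    fix i j assume ij: "i < N" "j < N"
    have s: "cnj (lam i) + lam j \<noteq> 0" using lam[OF ij(1)] lam[OF ij(2)] by (auto simp: complex_eq_iff)
    have nc: "1 + cnj (lam i) \<noteq> 0" using ne[OF ij(1)] by (auto simp: complex_eq_iff)
    have "1 - cnj (z i) * z j = 2 * (cnj (lam i) + lam j) / ((1 + cnj (lam i)) * (1 + lam j))"
      using ne[OF ij(2)] nc by (simp add: z_def divide_simps) (simp add: algebra_simps)
    then have *: "1 / (1 - cnj (z i) * z j) = (1 + cnj (lam i)) * (1 + lam j) / (2 * (cnj (lam i) + lam j))"
      by simp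
    have s2: "complex_of_real (sqrt 2) * of_real (sqrt 2) = 2"
      by (simp flip: of_real_mult)
    have "cnj (sqrt 2 / (1 + lam i)) * (X / (1 - cnj (z i) * z j)) * (sqrt 2 / (1 + lam j))
      = (complex_of_real (sqrt 2) * of_real (sqrt 2)) * X * (1 / (1 - cnj (z i) * z j)) / ((1 + cnj (lam i)) * (1 + lam j))" for X
      by (simp add: mult_ac)
    also have "\<dots> X = X / (cnj (lam i) + lam j)" for X
      unfolding * s2 using s nc ne[OF ij(2)] by (simp del: distrib_left_numeral)
    finally show "cnj (sqrt 2 / (1 + lam i)) * ((1 - cnj (f (z i)) * f (z j)) / (1 - cnj (z i) * z j)) * (sqrt 2 / (1 + lam j))
       = (1 - cnj (\<phi> (lam i)) * \<phi> (lam j)) / (cnj (lam i) + lam j)"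
      using fz ij by simp
  qed
qed

section \<open>Gaussian averages along vertical lines\<close>

lemma halfplane_simps [simp]: "s \<in> halfplane d \<longleftrightarrow> Re s > d"
  by (simp add: halfplane_def)

lemma open_halfplane [simp]: "open (halfplane d)"
  unfolding halfplane_def by (rule open_halfspace_Re_gt)

lemma Hinf_measurable_vertical:
  assumes "f holomorphic_on halfplane 0" "Re s > 0" "real_distribution M"
  shows "(\<lambda>u. f (s + \<i> * of_real (\<rho> * u))) \<in> borel_measurable M"
proof -
  interpret real_distribution M by fact
  have "continuous_on UNIV (\<lambda>u. f (s + \<i> * of_real (\<rho> * u)))"
    by (rule continuous_on_compose2[OF holomorphic_on_imp_continuous_on[OF assms(1)]])
       (use assms(2) in \<open>auto intro!: continuous_intros\<close>)
  then show ?thesis by (simp add: borel_measurable_continuous_onI)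
qed

text \<open>Cauchy's estimate on a disc of radius \<open>d\<close>. The constant is 2 because the
  estimate is applied with values in an open disc, while \<open>norm (\<phi> w) = 1\<close> is
  allowed.\<close>

lemma Hinf_deriv_bound:
  assumes \<phi>: "Hinf_unit_ball \<phi>" and d: "0 < d" "d < Re z"
  shows "norm (deriv \<phi> z) \<le> 2 / d"
proof -
  have sub: "cball z d \<subseteq> halfplane 0"
  proof
    fix w assume "w \<in> cball z d"
    then have "\<bar>Re (z - w)\<bar> \<le> d" using abs_Re_le_cmod[of "z - w"] by (simp add: dist_norm)
    with d show "w \<in> halfplane 0" by simp
  qed
  have hol: "\<phi> holomorphic_on halfplane 0" and le: "\<And>s. s \<in> halfplane 0 \<Longrightarrow> norm (\<phi> s) \<le> 1"
    using \<phi> by (auto simp: Hinf_unit_ball_def)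
  have "norm ((deriv ^^ 1) \<phi> z) \<le> fact 1 * 2 / d ^ 1"
  proof (rule Cauchy_higher_deriv_bound[where y = 0])
    show "\<phi> holomorphic_on ball z d"
      using hol sub ball_subset_cball by (blast intro: holomorphic_on_subset)
    show "continuous_on (cball z d) \<phi>"
      using holomorphic_on_imp_continuous_on[OF hol] sub by (rule continuous_on_subset)
    show "\<phi> w \<in> ball 0 2" if "w \<in> ball z d" for w
      using le[of w] that sub ball_subset_cball[of z d] by (force simp del: halfplane_simps)
  qed (use d in auto)
  then show ?thesis by simp
qed

text \<open>Differentiation under the integral sign: difference quotients are bounded uniformly
  along a vertical line, so dominated convergence against the probability measure applies.\<close>

lemma holomorphic_vertical_average:
  assumes \<phi>: "Hinf_unit_ball \<phi>" and M: "real_distribution M"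
  shows "(\<lambda>s. LINT u|M. \<phi> (s + \<i> * of_real (\<rho> * u))) holomorphic_on halfplane 0"
proof -
  interpret real_distribution M by fact
  have hol: "\<phi> holomorphic_on halfplane 0" and le: "\<And>s. s \<in> halfplane 0 \<Longrightarrow> norm (\<phi> s) \<le> 1"
    using \<phi> by (auto simp: Hinf_unit_ball_def)
  define F where "F s = (LINT u|M. \<phi> (s + \<i> * of_real (\<rho> * u)))" for s
  have int: "integrable M (\<lambda>u. \<phi> (s + \<i> * of_real (\<rho> * u)))" if "Re s > 0" for s
    by (rule integrable_const_bound[where B = 1])
       (use le that Hinf_measurable_vertical[OF hol that M] in auto)
  have "(F has_field_derivative (LINT u|M. deriv \<phi> (s + \<i> * of_real (\<rho> * u)))) (at s)" if s: "Re s > 0" for s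
  proof -
    \<comment> \<open>With \<open>Re s = 4 * d\<close>, the ball of radius \<open>2 * d\<close>
      about \<open>s\<close> stays in the region \<open>Re w > d\<close>, where the derivative is at
      most \<open>2 / d\<close>.\<close>
    define d where "d = Re s / 4"
    have d: "d > 0" using s by (simp add: d_def)
    have far: "d < Re w" if "w \<in> ball s (2 * d)" for w
    proof -
      have "\<bar>Re (s - w)\<bar> < 2 * d" using abs_Re_le_cmod[of "s - w"] that by (simp add: dist_norm)
      then show ?thesis using s unfolding d_def minus_complex.sel by linarith
    qed
    \<comment> \<open>Mean value inequality on the convex half-plane \<open>Re z > d\<close>. The
      bound does not depend on the height \<open>v\<close>, which is what makes it a dominating
      constant.\<close>
    have lip: "norm ((\<phi> (w + \<i> * of_real v) - \<phi> (s + \<i> * of_real v)) / (w - s)) \<le> 2 / d"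
      if w: "w \<in> ball s (2 * d)" "w \<noteq> s" for w v
    proof -
      have "norm (\<phi> (w + \<i> * of_real v) - \<phi> (s + \<i> * of_real v)) \<le> (2 / d) * norm ((w + \<i> * of_real v) - (s + \<i> * of_real v))"
      proof (rule field_differentiable_bound[where S = "{z. Re z > d}"])
        show "convex {z. Re z > d}" by (rule convex_halfspace_Re_gt)
        fix z assume z: "z \<in> {z. Re z > d}"
        show "(\<phi> has_field_derivative deriv \<phi> z) (at z within {z. Re z > d})"
          by (rule has_field_derivative_at_within, rule holomorphic_derivI[OF hol])
             (use z d in auto)
        show "norm (deriv \<phi> z) \<le> 2 / d" using Hinf_deriv_bound[OF \<phi> d] z by simp
      qed (use far[OF w(1)] far[of s] d in auto)
      then show ?thesis using w(2) by (simp add: norm_divide field_simps)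
    qed
    have "((\<lambda>w. (F w - F s) / (w - s)) \<longlongrightarrow> (LINT u|M. deriv \<phi> (s + \<i> * of_real (\<rho> * u)))) (at s within ball s (2 * d))"
      unfolding tendsto_at_iff_sequentially o_def
    proof (intro allI impI)
      fix X assume X: "\<forall>i. X i \<in> ball s (2 * d) - {s}" and lim: "X \<longlonglongrightarrow> s"
      define Q where "Q i u = (\<phi> (X i + \<i> * of_real (\<rho> * u)) - \<phi> (s + \<i> * of_real (\<rho> * u))) / (X i - s)" for i u
      have XRe: "Re (X i) > 0" for i using X far[of "X i"] d by fastforce
      have "(\<lambda>i. integral\<^sup>L M (Q i)) \<longlonglongrightarrow> (LINT u|M. deriv \<phi> (s + \<i> * of_real (\<rho> * u)))"
      proof (rule integral_dominated_convergence[where w = "\<lambda>_. 2 / d"])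
        show "(\<lambda>u. deriv \<phi> (s + \<i> * of_real (\<rho> * u))) \<in> borel_measurable M"
          by (rule Hinf_measurable_vertical[OF holomorphic_deriv[OF hol] s M]) simp
        show "Q i \<in> borel_measurable M" for i
          unfolding Q_def
          by (intro borel_measurable_divide borel_measurable_diff borel_measurable_const
              Hinf_measurable_vertical[OF hol _ M] XRe s)
        show "AE u in M. (\<lambda>i. Q i u) \<longlonglongrightarrow> deriv \<phi> (s + \<i> * of_real (\<rho> * u))"
        proof (rule AE_I2)
          fix u
          define z where "z = s + \<i> * of_real (\<rho> * u)"
          have "(\<phi> has_field_derivative deriv \<phi> z) (at z)"
            by (rule holomorphic_derivI[OF hol]) (use s in \<open>auto simp: z_def\<close>)
          then have "((\<lambda>w. (\<phi> w - \<phi> z) / (w - z)) \<longlongrightarrow> deriv \<phi> z) (at z)"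
            by (simp add: has_field_derivative_iff)
          then have "(\<lambda>i. (\<phi> (X i + \<i> * of_real (\<rho> * u)) - \<phi> z) / (X i + \<i> * of_real (\<rho> * u) - z)) \<longlonglongrightarrow> deriv \<phi> z"
          proof (rule filterlim_compose)
            have "(\<lambda>i. X i + \<i> * of_real (\<rho> * u)) \<longlonglongrightarrow> z" unfolding z_def by (intro tendsto_intros lim)
            moreover have "\<forall>\<^sub>F i in sequentially. X i + \<i> * of_real (\<rho> * u) \<in> UNIV - {z}"
              using X by (auto simp: z_def)
            ultimately show "filterlim (\<lambda>i. X i + \<i> * of_real (\<rho> * u)) (at z) sequentially"
              by (simp add: filterlim_at)
          qed
          then show "(\<lambda>i. Q i u) \<longlonglongrightarrow> deriv \<phi> (s + \<i> * of_real (\<rho> * u))"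
            by (simp add: Q_def z_def)
        qed
        show "AE u in M. norm (Q i u) \<le> 2 / d" for i
          unfolding Q_def using X by (intro AE_I2 lip) auto
      qed simp
      moreover have "integral\<^sup>L M (Q i) = (F (X i) - F s) / (X i - s)" for i
        unfolding Q_def F_def using int[OF XRe, of i] int[OF s] by simp
      ultimately show "(\<lambda>i. (F (X i) - F s) / (X i - s)) \<longlonglongrightarrow> (LINT u|M. deriv \<phi> (s + \<i> * of_real (\<rho> * u)))"
        by simp
    qed
    then show ?thesis
      using at_within_open[of s "ball s (2 * d)"] d by (simp add: has_field_derivative_iff)
  qed
  then show ?thesis
    unfolding F_def[abs_def, symmetric] holomorphic_on_open[OF open_halfplane]
    by (blast dest: halfplane_simps[THEN iffD1])
qed

lemma norm_vertical_average_le: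
  assumes \<phi>: "Hinf_unit_ball \<phi>" and M: "real_distribution M" and s: "Re s > 0"
  shows "norm (LINT u|M. \<phi> (s + \<i> * of_real (\<rho> * u))) \<le> 1"
proof -
  interpret real_distribution M by fact
  have "norm (LINT u|M. \<phi> (s + \<i> * of_real (\<rho> * u))) \<le> (LINT u|M. norm (\<phi> (s + \<i> * of_real (\<rho> * u))))"
    by (rule integral_norm_bound)
  also have "\<dots> \<le> (LINT u|M. 1)"
    by (rule integral_mono_AE', simp, rule AE_I2)
       (use \<phi> s in \<open>auto simp: Hinf_unit_ball_def\<close>)
  finally show ?thesis using prob_space by simp
qed

text \<open>Dominated convergence with the constant 1. The shift \<open>\<delta>\<close> is carried
  along because the later approximants also push the imaginary axis into the open
  half-plane.\<close>

lemma vertical_average_tendsto: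
  assumes \<phi>: "Hinf_unit_ball \<phi>" and M: "real_distribution M" and s: "Re s > 0"
    and \<delta>: "\<And>k. \<delta> k \<ge> 0" "\<delta> \<longlonglongrightarrow> 0" and \<rho>: "\<rho> \<longlonglongrightarrow> 0"
  shows "(\<lambda>k. LINT u|M. \<phi> (s + of_real (\<delta> k) + \<i> * of_real (\<rho> k * u))) \<longlonglongrightarrow> \<phi> s"
proof -
  interpret real_distribution M by fact
  have hol: "\<phi> holomorphic_on halfplane 0" and le: "\<And>s. s \<in> halfplane 0 \<Longrightarrow> norm (\<phi> s) \<le> 1"
    using \<phi> by (auto simp: Hinf_unit_ball_def)
  have pos: "Re (s + of_real (\<delta> k)) > 0" for k using s \<delta>(1)[of k] by simp
  have "(\<lambda>k. LINT u|M. \<phi> (s + of_real (\<delta> k) + \<i> * of_real (\<rho> k * u))) \<longlonglongrightarrow> (LINT u|M. \<phi> s)"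
  proof (rule integral_dominated_convergence[where w = "\<lambda>_. 1"])
    show "AE u in M. (\<lambda>k. \<phi> (s + of_real (\<delta> k) + \<i> * of_real (\<rho> k * u))) \<longlonglongrightarrow> \<phi> s"
    proof (rule AE_I2, rule continuous_on_tendsto_compose[OF holomorphic_on_imp_continuous_on[OF hol]])
      fix u
      have "(\<lambda>k. s + of_real (\<delta> k) + \<i> * of_real (\<rho> k * u)) \<longlonglongrightarrow> s + of_real 0 + \<i> * of_real (0 * u)"
        by (intro tendsto_intros \<delta> \<rho>)
      then show "(\<lambda>k. s + of_real (\<delta> k) + \<i> * of_real (\<rho> k * u)) \<longlonglongrightarrow> s" by simp
    qed (use s pos in auto)
    show "AE u in M. norm (\<phi> (s + of_real (\<delta> k) + \<i> * of_real (\<rho> k * u))) \<le> 1" for k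
      using pos[of k] by (intro AE_I2 le) simp
  qed (use Hinf_measurable_vertical[OF hol pos M] in auto)
  then show ?thesis using prob_space by simp
qed

section \<open>Dirichlet series and their Gaussian averages\<close>

definition ln_Suc :: "nat \<Rightarrow> real" where
  "ln_Suc n = ln (real (Suc n))"

lemma ln_Suc_nonneg [simp]: "ln_Suc n \<ge> 0"
  by (simp add: ln_Suc_def)

lemma of_nat_Suc_powr: "(of_nat (Suc n) :: complex) powr s = exp (s * of_real (ln_Suc n))"
proof -
  have "Ln (of_nat (Suc n)) = of_real (ln (real (Suc n)))"
    by (subst Ln_of_real [symmetric]) auto
  then show ?thesis by (simp add: powr_def ln_Suc_def del: of_nat_Suc)
qed

lemma summable_exp_ln_Suc:
  assumes "x > 1"
  shows "summable (\<lambda>n. exp (- (x * ln_Suc n)))"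
proof -
  have "summable (\<lambda>n. of_nat n powr (- x) :: real)" using assms by (simp add: summable_real_powr_iff)
  then have "summable (\<lambda>n. of_nat (Suc n) powr (- x) :: real)" by (subst summable_Suc_iff)
  moreover have "of_nat (Suc n) powr (- x) = exp (- (x * ln_Suc n))" for n
    by (simp add: powr_def ln_Suc_def del: of_nat_Suc)
  ultimately show ?thesis by simp
qed

text \<open>Convergence at the single point \<open>p\<close> makes the terms there bounded, which is
  polynomial growth of the coefficients. The choice \<open>\<bar>\<sigma>\<bar> + 1\<close> is
  positive and exceeds \<open>\<sigma>\<close>.\<close>

lemma dirichlet_representableE:
  assumes "dirichlet_representable f"
  obtains b C p where "p > 0" "\<And>n. norm (b n) \<le> C * exp (p * ln_Suc n)"
    "\<And>s. Re s > p \<Longrightarrow> (\<lambda>n. b n * exp (- s * of_real (ln_Suc n))) sums f s"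
proof -
  obtain a \<sigma> where a: "\<And>s. Re s > \<sigma> \<Longrightarrow> (\<lambda>n. a (Suc n) * (of_nat (Suc n)) powr (- s)) sums f s"
    using assms unfolding dirichlet_representable_def by blast
  define b where "b n = a (Suc n)" for n
  define p where "p = \<bar>\<sigma>\<bar> + 1"
  have b: "(\<lambda>n. b n * exp (- s * of_real (ln_Suc n))) sums f s" if "Re s > \<sigma>" for s
    using a[OF that] unfolding of_nat_Suc_powr b_def .
  have "(\<lambda>n. b n * exp (- of_real p * of_real (ln_Suc n))) \<longlonglongrightarrow> 0"
    by (rule summable_LIMSEQ_zero[OF sums_summable[OF b]]) (simp add: p_def)
  then have "Bseq (\<lambda>n. b n * exp (- of_real p * of_real (ln_Suc n)))"
    by (rule convergent_imp_Bseq[OF convergentI])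
  then obtain C where C: "\<And>n. norm (b n * exp (- of_real p * of_real (ln_Suc n))) \<le> C"
    by (auto simp: Bseq_def)
  have "norm (b n) \<le> C * exp (p * ln_Suc n)" for n
  proof -
    have "norm (b n) * exp (- (p * ln_Suc n)) \<le> C"
      using C[of n] by (simp add: norm_mult)
    then show ?thesis by (simp add: exp_minus field_simps)
  qed
  moreover have "p > 0" by (simp add: p_def)
  moreover have "(\<lambda>n. b n * exp (- s * of_real (ln_Suc n))) sums f s" if "Re s > p" for s
    by (rule b) (use that in \<open>simp add: p_def\<close>)
  ultimately show ?thesis using that by blast
qed

text \<open>Averaging multiplies the \<open>n\<close>th term by the characteristic function of the
  normal law at \<open>- (\<rho> * ln_Suc n)\<close>, a factor that decays faster than any power of
  \<open>n\<close>. The identity is checked far to the right and continued analytically to the whole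
  right half-plane.\<close>

lemma gaussian_average_eq_series:
  assumes \<phi>: "Hinf_unit_ball \<phi>"
    and p: "p > 0" and b: "\<And>n. norm (b n) \<le> C * exp (p * ln_Suc n)"
    and sums: "\<And>s. Re s > p \<Longrightarrow> (\<lambda>n. b n * exp (- s * of_real (ln_Suc n))) sums \<phi> s"
    and \<rho>: "\<rho> > 0"
  defines "q \<equiv> \<lambda>n. b n * of_real (exp (- ((\<rho> * ln_Suc n)\<^sup>2) / 2))"
  shows "summable (\<lambda>n. norm (q n))" (is ?A)
    and "\<And>s. Re s > 0 \<Longrightarrow> (LINT u|std_normal_distribution. \<phi> (s + \<i> * of_real (\<rho> * u)))
               = (\<Sum>n. q n * exp (- s * of_real (ln_Suc n)))" (is "\<And>s. _ \<Longrightarrow> ?F s = ?G s")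
proof -
  let ?M = "std_normal_distribution"
  note M = real_dist_normal_dist
  interpret real_distribution ?M by (rule M)
  have C0: "C \<ge> 0" using b[of 0] norm_ge_zero[of "b 0"]
    by (smt (verit) exp_gt_zero mult_neg_pos)
  show q: ?A
  proof (rule summable_comparison_test')
    \<comment> \<open>The maximum over real \<open>x\<close> of
      \<open>(p + 2) * x - (\<rho> * x)^2 / 2\<close>, attained at
      \<open>x = (p + 2) / \<rho>^2\<close>.\<close>
    define D where "D = (p + 2)\<^sup>2 / (2 * \<rho>\<^sup>2)"
    show "summable (\<lambda>n. C * exp D * exp (- (2 * ln_Suc n)))"
      by (intro summable_mult summable_exp_ln_Suc) simp
    show "norm (norm (q n)) \<le> C * exp D * exp (- (2 * ln_Suc n))" for n
    proof -
      \<comment> \<open>Completing the square: the Gaussian factor beats \<open>n powr (p + 2)\<close>.\<close>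
      have "0 \<le> (\<rho> * ln_Suc n - (p + 2) / \<rho>)\<^sup>2" by simp
      also have "\<dots> = (\<rho> * ln_Suc n)\<^sup>2 - 2 * (p + 2) * ln_Suc n + 2 * D"
        using \<rho> by (simp add: power2_diff D_def power_divide)
      finally have le: "p * ln_Suc n + - ((\<rho> * ln_Suc n)\<^sup>2) / 2 \<le> D + - (2 * ln_Suc n)"
        by (simp add: algebra_simps)
      have "norm (q n) \<le> C * exp (p * ln_Suc n) * exp (- ((\<rho> * ln_Suc n)\<^sup>2) / 2)"
        unfolding q_def norm_mult norm_of_real abs_exp_cancel by (intro mult_right_mono b) simp
      also have "\<dots> = C * exp (p * ln_Suc n + - ((\<rho> * ln_Suc n)\<^sup>2) / 2)"
        by (simp only: exp_add mult.assoc)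
      also have "\<dots> \<le> C * exp (D + - (2 * ln_Suc n))"
        using le C0 by (intro mult_left_mono) simp_all
      finally have "norm (q n) \<le> C * exp D * exp (- (2 * ln_Suc n))"
        by (simp only: exp_add mult.assoc)
      then show ?thesis by simp
    qed
  qed
  \<comment> \<open>Two units beyond the growth exponent \<open>p\<close> the terms are dominated by
    inverse squares, uniformly in \<open>u\<close>, so sum and integral may be interchanged.\<close>
  have right: "?F s = ?G s" if s: "Re s > p + 2" for s
  proof -
    define f where "f n u = b n * exp (- (s + \<i> * of_real (\<rho> * u)) * of_real (ln_Suc n))" for n u
    have f_eq: "f n u = b n * exp (- s * of_real (ln_Suc n)) * iexp ((- (\<rho> * ln_Suc n)) * u)" for n u
      unfolding f_def mult.assoc by (simp add: exp_add [symmetric] algebra_simps)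
    have norm_f: "norm (f n u) = norm (b n) * exp (- (Re s * ln_Suc n))" for n u
      unfolding f_eq by (simp add: norm_mult)
    have int_f: "integrable ?M (f n)" for n
      unfolding f_eq by (intro integrable_mult_right integrable_iexp) auto
    have summ: "summable (\<lambda>n. norm (b n) * exp (- (Re s * ln_Suc n)))"
    proof (rule summable_comparison_test')
      show "summable (\<lambda>n. C * exp (- (2 * ln_Suc n)))"
        by (intro summable_mult summable_exp_ln_Suc) simp
      show "norm (norm (b n) * exp (- (Re s * ln_Suc n))) \<le> C * exp (- (2 * ln_Suc n))" for n
      proof -
        have "norm (b n) * exp (- (Re s * ln_Suc n)) \<le> C * exp (p * ln_Suc n) * exp (- (Re s * ln_Suc n))"
          by (intro mult_right_mono b) simp
        also have "\<dots> = C * exp ((p - Re s) * ln_Suc n)"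
          by (simp add: mult.assoc exp_add [symmetric] algebra_simps)
        also have "\<dots> \<le> C * exp (- 2 * ln_Suc n)"
        proof (intro mult_left_mono C0)
          have "(p - Re s) * ln_Suc n \<le> - 2 * ln_Suc n"
            using s by (intro mult_right_mono) auto
          then show "exp ((p - Re s) * ln_Suc n) \<le> exp (- 2 * ln_Suc n)" by simp
        qed
        finally show ?thesis by simp
      qed
    qed
    have "(LINT u|?M. (\<Sum>n. f n u)) = (\<Sum>n. integral\<^sup>L ?M (f n))"
    proof (rule integral_suminf[OF int_f])
      show "AE u in ?M. summable (\<lambda>n. norm (f n u))" unfolding norm_f using summ by simp
      show "summable (\<lambda>n. LINT u|?M. norm (f n u))" unfolding norm_f using summ prob_space
        by simp
    qed
    moreover have "(\<Sum>n. f n u) = \<phi> (s + \<i> * of_real (\<rho> * u))" for u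
      unfolding f_def by (rule sums_unique[symmetric, OF sums]) (use s p in simp)
    moreover have "integral\<^sup>L ?M (f n) = q n * exp (- s * of_real (ln_Suc n))" for n
    proof -
      have "integral\<^sup>L ?M (f n) = b n * exp (- s * of_real (ln_Suc n)) * char ?M (- (\<rho> * ln_Suc n))"
        unfolding f_eq char_def by (rule integral_mult_right_zero)
      then show ?thesis by (simp add: char_std_normal_distribution q_def mult_ac)
    qed
    ultimately show ?thesis by simp
  qed
  \<comment> \<open>On \<open>Re s > 0\<close> the exponentials have modulus at most 1, so
    \<open>norm (q n)\<close> serves as majorant in the Weierstrass test.\<close>
  have holG: "?G holomorphic_on halfplane 0"
  proof (rule holomorphic_uniform_sequence[OF open_halfplane])
    show "(\<lambda>s. \<Sum>n<k. q n * exp (- s * of_real (ln_Suc n))) holomorphic_on halfplane 0" for k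
      by (intro holomorphic_intros)
    have "uniform_limit (halfplane 0) (\<lambda>k s. \<Sum>n<k. q n * exp (- s * of_real (ln_Suc n))) ?G sequentially"
    proof (rule Weierstrass_m_test[OF _ q])
      fix n s assume "s \<in> halfplane 0"
      then show "norm (q n * exp (- s * of_real (ln_Suc n))) \<le> norm (q n)"
        by (auto simp: norm_mult intro!: mult_left_le)
    qed
    moreover fix s assume "s \<in> halfplane 0"
    then obtain d where "d > 0" "cball s d \<subseteq> halfplane 0"
      using open_halfplane open_contains_cball by blast
    ultimately show "\<exists>d>0. cball s d \<subseteq> halfplane 0 \<and>
        uniform_limit (cball s d) (\<lambda>k s. \<Sum>n<k. q n * exp (- s * of_real (ln_Suc n))) ?G sequentially"
      by (blast intro: uniform_limit_on_subset)
  qed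
  show "?F s = ?G s" if "Re s > 0" for s
  proof (rule analytic_continuation_open[where f = ?F and g = ?G and z = s and s = "halfplane (p + 2)" and s' = "halfplane 0"])
    have "of_real (p + 3) \<in> halfplane (p + 2)" by simp
    then show "halfplane (p + 2) \<noteq> {}" by blast
    show "connected (halfplane 0)"
      unfolding halfplane_def by (intro convex_connected convex_halfspace_Re_gt)
    show "halfplane (p + 2) \<subseteq> halfplane 0" using p by auto
    show "?F holomorphic_on halfplane 0" by (rule holomorphic_vertical_average[OF \<phi> M])
  qed (use right holG that in auto)
qed

section \<open>The zeta kernel\<close>

text \<open>Here \<open>\<psi> j n\<close> is \<open>n + 1\<close> to the power
  \<open>- lam j\<close>, square-summable exactly because \<open>Re (lam j) > 1 / 2\<close>, and the
  Gram matrix consists of zeta values. Gaussian averaging supplies the absolutely summable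
  multiplier.\<close>

lemma psd_kernel_zeta:
  assumes \<phi>: "Hinf_unit_ball \<phi>" and D: "dirichlet_representable \<phi>"
    and lam: "\<And>j. j < N \<Longrightarrow> Re (lam j) > 1 / 2"
  shows "psd_kernel N (\<lambda>i j. (1 - cnj (\<phi> (lam i)) * \<phi> (lam j)) * zeta (cnj (lam i) + lam j))"
proof -
  obtain b C p where p: "p > 0" and b: "\<And>n. norm (b n) \<le> C * exp (p * ln_Suc n)"
    and sums: "\<And>s. Re s > p \<Longrightarrow> (\<lambda>n. b n * exp (- s * of_real (ln_Suc n))) sums \<phi> s"
    by (rule dirichlet_representableE[OF D]) (rule that)
  define \<delta> where "\<delta> k = 1 / real (Suc k)" for k
  have \<delta>: "\<delta> k > 0" for k by (simp add: \<delta>_def)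
  have \<delta>0: "\<delta> \<longlonglongrightarrow> 0" unfolding \<delta>_def by (rule LIMSEQ_Suc[OF lim_1_over_n])
  \<comment> \<open>One parameter \<open>\<delta> k\<close> serves as both Gaussian width and
    horizontal shift. The shift makes \<open>F k\<close> available on the imaginary axis, where the
    multiplier must be bounded by 1.\<close>
  define F where "F k s = (LINT u|std_normal_distribution. \<phi> (s + of_real (\<delta> k) + \<i> * of_real (\<delta> k * u)))" for k s
  have zeta: "zeta (cnj (lam i) + lam j) = (\<Sum>n. cnj (exp (- lam i * of_real (ln_Suc n))) * exp (- lam j * of_real (ln_Suc n)))" for i j
    unfolding zeta_def of_nat_Suc_powr
  proof (rule suminf_cong)
    fix n
    let ?L = "complex_of_real (ln_Suc n)"
    have "1 / exp ((cnj (lam i) + lam j) * ?L) = exp (- ((cnj (lam i) + lam j) * ?L))"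
      by (simp add: exp_minus inverse_eq_divide)
    also have "- ((cnj (lam i) + lam j) * ?L) = cnj (- lam i * ?L) + (- lam j * ?L)"
      by (simp add: algebra_simps)
    finally show "1 / exp ((cnj (lam i) + lam j) * ?L) = cnj (exp (- lam i * ?L)) * exp (- lam j * ?L)"
      by (simp only: exp_add exp_cnj)
  qed
  have "psd_kernel N (\<lambda>i j. (1 - cnj (F k (lam i)) * F k (lam j)) * zeta (cnj (lam i) + lam j))" for k
  proof -
    define q where "q n = b n * of_real (exp (- ((\<delta> k * ln_Suc n)\<^sup>2) / 2))" for n
    have q: "summable (\<lambda>n. norm (q n))"
      unfolding q_def by (rule gaussian_average_eq_series(1)[OF \<phi> p b sums \<delta>])
    have series: "(LINT u|std_normal_distribution. \<phi> (s + \<i> * of_real (\<delta> k * u)))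
        = (\<Sum>n. q n * exp (- s * of_real (ln_Suc n)))" if "Re s > 0" for s
      unfolding q_def by (rule gaussian_average_eq_series(2)[OF \<phi> p b sums \<delta> that])
    \<comment> \<open>Absorbs the shift into the coefficients, so that \<open>F k\<close> becomes a
      Dirichlet series in the unshifted variable.\<close>
    define r where "r n = q n * exp (- of_real (\<delta> k * ln_Suc n))" for n
    have F: "F k s = (\<Sum>n. r n * exp (- s * of_real (ln_Suc n)))" if "Re s \<ge> 0" for s
    proof -
      have "Re (s + of_real (\<delta> k)) > 0" using that \<delta>[of k] by simp
      from series[OF this] show ?thesis
        unfolding F_def r_def mult.assoc by (simp add: exp_add [symmetric] algebra_simps)
    qed
    have "psd_kernel N (\<lambda>i j. (1 - cnj (\<Sum>n. r n * exp (- lam i * of_real (ln_Suc n))) * (\<Sum>n. r n * exp (- lam j * of_real (ln_Suc n))))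
       * (\<Sum>n. cnj (exp (- lam i * of_real (ln_Suc n))) * exp (- lam j * of_real (ln_Suc n))))"
    proof (rule psd_kernel_multiplier[where l = ln_Suc and opr = "\<lambda>m n. Suc m * Suc n - 1"])
      show "inj ln_Suc" by (auto simp: inj_on_def ln_Suc_def)
      show l: "ln_Suc (Suc m * Suc n - 1) = ln_Suc m + ln_Suc n" for m n
      proof -
        have "Suc (Suc m * Suc n - 1) = Suc m * Suc n" by simp
        then have "real (Suc (Suc m * Suc n - 1)) = real (Suc m) * real (Suc n)"
          by (simp only: of_nat_mult)
        then show ?thesis unfolding ln_Suc_def by (simp only: ln_mult_pos of_nat_0_less_iff zero_less_Suc)
      qed
      show "exp (- lam j * of_real (ln_Suc (Suc m * Suc n - 1))) =
            exp (- lam j * of_real (ln_Suc m)) * exp (- lam j * of_real (ln_Suc n))" for j m n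
        unfolding l by (simp add: exp_add [symmetric] algebra_simps)
      fix j assume "j < N"
      note lam = lam[OF this]
      show "norm (exp (- lam j * of_real (ln_Suc m))) \<le> 1" for m
        using lam by simp
      have "(norm (exp (- lam j * of_real (ln_Suc m))))\<^sup>2 = exp (- ((2 * Re (lam j)) * ln_Suc m))" for m
        by (simp add: exp_double [symmetric] algebra_simps)
      then show "summable (\<lambda>m. (norm (exp (- lam j * of_real (ln_Suc m))))\<^sup>2)"
        using summable_exp_ln_Suc[of "2 * Re (lam j)"] lam by simp
    next
      show "summable (\<lambda>n. norm (r n))"
      proof (rule summable_comparison_test'[OF q])
        show "norm (norm (r n)) \<le> norm (q n)" for n
          using \<delta>[of k] by (auto simp: r_def norm_mult intro!: mult_left_le)
      qed
      show "norm (\<Sum>m. r m * cis (- (ln_Suc m * t))) \<le> 1" for t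
      proof -
        have "(\<Sum>m. r m * cis (- (ln_Suc m * t))) = F k (\<i> * of_real t)"
          by (subst F) (simp_all add: cis_conv_exp mult_ac)
        then show ?thesis
          unfolding F_def using norm_vertical_average_le[OF \<phi> real_dist_normal_dist, of "\<i> * of_real t + of_real (\<delta> k)"]
            \<delta>[of k] by simp
      qed
    qed
    then show ?thesis
    proof (rule psd_kernel_cong[THEN iffD1, rotated])
      fix i j assume "i < N" "j < N"
      then have "Re (lam i) \<ge> 0" "Re (lam j) \<ge> 0" using lam[of i] lam[of j] by auto
      then show "(1 - cnj (\<Sum>n. r n * exp (- lam i * of_real (ln_Suc n))) * (\<Sum>n. r n * exp (- lam j * of_real (ln_Suc n))))
         * (\<Sum>n. cnj (exp (- lam i * of_real (ln_Suc n))) * exp (- lam j * of_real (ln_Suc n)))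
         = (1 - cnj (F k (lam i)) * F k (lam j)) * zeta (cnj (lam i) + lam j)"
        by (simp only: F zeta)
    qed
  qed
  then show ?thesis
  proof (rule psd_kernel_limit)
    have "(\<lambda>k. F k (lam j)) \<longlonglongrightarrow> \<phi> (lam j)" if "j < N" for j
      unfolding F_def
      by (rule vertical_average_tendsto[OF \<phi> real_dist_normal_dist])
         (use lam[OF that] \<delta> \<delta>0 in \<open>auto intro: less_imp_le\<close>)
    then show "(\<lambda>k. (1 - cnj (F k (lam i)) * F k (lam j)) * zeta (cnj (lam i) + lam j))
        \<longlonglongrightarrow> (1 - cnj (\<phi> (lam i)) * \<phi> (lam j)) * zeta (cnj (lam i) + lam j)" if "i < N" "j < N" for i j
      using that by (intro tendsto_intros) auto
  qed
qed

section \<open>Nondegeneracy of the Pick matrix\<close>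

text \<open>If the added row had a nonzero product \<open>r\<close> with the null vector, a small
  multiple of \<open>- r\<close> in the new coordinate would make the form negative: its linear term
  is negative and outweighs the quadratic one.\<close>

lemma psd_kernel_null_row:
  assumes psd: "psd_kernel (Suc n) K"
    and herm: "\<And>i. i < n \<Longrightarrow> K i n = cnj (K n i)"
    and null: "(\<Sum>i<n. \<Sum>j<n. cnj (c i) * K i j * c j) = 0"
  shows "(\<Sum>j<n. K n j * c j) = 0"
proof (rule ccontr)
  define r where "r = (\<Sum>j<n. K n j * c j)"
  assume "(\<Sum>j<n. K n j * c j) \<noteq> 0"
  then have r: "norm r > 0" by (simp add: r_def)
  define k where "k = Re (K n n)"
  \<comment> \<open>With \<open>x = - \<epsilon> * r\<close> the form is
    \<open>\<epsilon> * (\<epsilon> * k - 2)\<close> times the squared norm of \<open>r\<close>.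
    This \<open>\<epsilon>\<close> makes \<open>\<epsilon> * k < 2\<close> whatever the size of
    \<open>k\<close>.\<close>
  define \<epsilon> where "\<epsilon> = 1 / (1 + \<bar>k\<bar>)"
  define x where "x = - of_real \<epsilon> * r"
  have form: "(\<Sum>i<Suc n. \<Sum>j<Suc n. cnj ((c(n := x)) i) * K i j * (c(n := x)) j)
     = cnj r * x + cnj x * r + cnj x * K n n * x"
  proof -
    have "(\<Sum>i<Suc n. \<Sum>j<Suc n. cnj ((c(n := x)) i) * K i j * (c(n := x)) j)
       = (\<Sum>i<n. \<Sum>j<n. cnj (c i) * K i j * c j) + (\<Sum>i<n. cnj (c i) * K i n * x)
         + ((\<Sum>j<n. cnj x * K n j * c j) + cnj x * K n n * x)"
      by (simp add: sum.distrib)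
    also have "(\<Sum>i<n. cnj (c i) * K i n * x) = cnj r * x"
      by (simp add: r_def sum_distrib_left herm mult_ac)
    also have "(\<Sum>j<n. cnj x * K n j * c j) = cnj x * r"
      by (simp add: r_def sum_distrib_left mult_ac)
    finally show ?thesis by (simp add: null)
  qed
  have "0 \<le> Re (cnj r * x + cnj x * r + cnj x * K n n * x)"
    using psd[unfolded psd_kernel_def, rule_format, of "c(n := x)"] unfolding form
    by (simp add: complex_nonneg_Reals_iff)
  also have "\<dots> = (norm r)\<^sup>2 * (\<epsilon> * (\<epsilon> * k - 2))"
    unfolding cmod_power2 k_def x_def by (simp add: power2_eq_square algebra_simps)
  finally have "0 \<le> (norm r)\<^sup>2 * (\<epsilon> * (\<epsilon> * k - 2))" .
  moreover have "0 < (norm r)\<^sup>2" "0 < \<epsilon>" using r by (auto simp: \<epsilon>_def)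
  ultimately have "0 \<le> \<epsilon> * k - 2" by (simp only: zero_le_mult_iff) linarith
  moreover have "\<epsilon> * k < 2" by (simp add: \<epsilon>_def field_simps)
  ultimately show False by simp
qed

section \<open>Polynomials against exponential decay\<close>

lemma poly_eq_0_of_tendsto_0:
  fixes g :: "complex poly"
  assumes "((\<lambda>x. poly g (of_real x)) \<longlongrightarrow> 0) at_top"
  shows "g = 0"
proof (cases "degree g = 0")
  case True
  then obtain a where g: "g = [:a:]" by (rule degree_eq_zeroE)
  with assms have "((\<lambda>x::real. a) \<longlongrightarrow> 0) at_top" by simp
  then have "a = 0" by (simp add: tendsto_const_iff)
  with g show ?thesis by simp
next
  case False
  have "filterlim (\<lambda>x. complex_of_real x) at_infinity at_top"
    unfolding filterlim_at_infinity_conv_norm_at_top norm_of_real by (rule filterlim_abs_real)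
  then have "filterlim (\<lambda>x. poly g (of_real x)) at_infinity at_top"
    using filterlim_poly_at_infinity False by (blast intro: filterlim_compose)
  with assms show ?thesis
    using not_tendsto_and_filterlim_at_infinity[OF trivial_limit_at_top_linorder] by blast
qed

lemma poly_times_exp_tendsto_0:
  fixes h :: "complex poly"
  shows "((\<lambda>x. poly h (of_real x) * of_real (exp (- (x * ln 2)))) \<longlongrightarrow> 0) at_top"
proof -
  have "((\<lambda>x::real. x ^ k * exp (- (x * ln 2))) \<longlongrightarrow> 0) at_top" for k :: nat
    by real_asymp
  then have "((\<lambda>x. \<Sum>k\<le>degree h. coeff h k * of_real (x ^ k * exp (- (x * ln 2)))) \<longlongrightarrow> (\<Sum>k\<le>degree h. coeff h k * of_real 0)) at_top"
    by (intro tendsto_intros)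
  then show ?thesis by (simp add: poly_altdef sum_distrib_left mult_ac)
qed

text \<open>After the constant term the smallest frequency is \<open>ln 2\<close>, so the remainder
  decays like 2 to the power \<open>- x\<close>.\<close>

lemma dirichlet_exponential_limit:
  assumes "dirichlet_representable f"
  obtains a C x0 where "\<And>x. x \<ge> x0 \<Longrightarrow> norm (f (of_real x) - a) \<le> C * exp (- (x * ln 2))"
proof -
  obtain p b C where p: "p > 0" and b: "\<And>n. norm (b n) \<le> C * exp (p * ln_Suc n)"
    and sums: "\<And>s. Re s > p \<Longrightarrow> (\<lambda>n. b n * exp (- s * of_real (ln_Suc n))) sums f s"
    by (rule dirichlet_representableE[OF assms]) (rule that)
  have C0: "C \<ge> 0" using b[of 0] norm_ge_zero[of "b 0"]
    by (smt (verit) exp_gt_zero mult_neg_pos)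
  define S where "S = (\<Sum>n. C * exp (- (2 * ln_Suc (Suc n))))"
  have summ: "summable (\<lambda>n. C * exp (- (2 * ln_Suc (Suc n))))"
    using summable_exp_ln_Suc[of 2] by (intro summable_mult) (subst summable_Suc_iff, simp)
  show ?thesis
  proof (rule that)
    fix x assume x: "x \<ge> p + 2"
    \<comment> \<open>The term bound \<open>exp ((p - x) * L)\<close> splits into
      \<open>exp (- (2 * L))\<close>, which is summable, and
      \<open>exp (- ((x - p - 2) * L))\<close>. As \<open>L \<ge> ln 2\<close> and
      \<open>x \<ge> p + 2\<close>, the latter is at most \<open>D\<close>, which does not depend on
      the term.\<close>
    define D where "D = exp (- ((x - p - 2) * ln 2))"
    have bound: "norm (b (Suc n) * exp (- of_real x * of_real (ln_Suc (Suc n)))) \<le> C * exp (- (2 * ln_Suc (Suc n))) * D" for n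
    proof -
      let ?L = "ln_Suc (Suc n)"
      have "norm (b (Suc n) * exp (- of_real x * of_real ?L)) \<le> C * exp (p * ?L) * exp (- (x * ?L))"
        unfolding norm_mult by (intro mult_mono b) (use C0 in auto)
      also have "\<dots> = C * exp (- (2 * ?L)) * exp (- ((x - p - 2) * ?L))"
        by (simp add: mult.assoc exp_add [symmetric] algebra_simps)
      also have "\<dots> \<le> C * exp (- (2 * ?L)) * D"
        unfolding D_def
      proof (intro mult_left_mono)
        have "(x - p - 2) * ln 2 \<le> (x - p - 2) * ?L"
          using x by (intro mult_left_mono) (auto simp: ln_Suc_def)
        then show "exp (- ((x - p - 2) * ?L)) \<le> exp (- ((x - p - 2) * ln 2))" by simp
      qed (use C0 in auto)
      finally show ?thesis .
    qed
    have s: "(\<lambda>n. b n * exp (- of_real x * of_real (ln_Suc n))) sums f (of_real x)"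
      by (rule sums) (use x p in simp)
    have sn: "summable (\<lambda>n. norm (b (Suc n) * exp (- of_real x * of_real (ln_Suc (Suc n)))))"
      by (rule summable_comparison_test'[OF summable_mult2[OF summ, of D]]) (use bound in simp)
    \<comment> \<open>Since \<open>ln_Suc 0 = 0\<close>, the term split off is the constant
      \<open>b 0\<close>.\<close>
    have "(\<lambda>n. b (Suc n) * exp (- of_real x * of_real (ln_Suc (Suc n)))) sums (f (of_real x) - b 0)"
      using s sums_Suc_iff[of "\<lambda>n. b n * exp (- of_real x * of_real (ln_Suc n))"] by (simp add: ln_Suc_def)
    then have "norm (f (of_real x) - b 0) \<le> (\<Sum>n. norm (b (Suc n) * exp (- of_real x * of_real (ln_Suc (Suc n)))))"
      using summable_norm[OF sn] sums_unique by fastforce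
    also have "\<dots> \<le> (\<Sum>n. C * exp (- (2 * ln_Suc (Suc n))) * D)"
      by (rule suminf_le[OF bound sn summable_mult2[OF summ]])
    also have "\<dots> = S * D" unfolding S_def by (rule suminf_mult2[OF summ, symmetric])
    also have "\<dots> = S * exp ((p + 2) * ln 2) * exp (- (x * ln 2))"
      unfolding D_def mult.assoc by (simp add: exp_add [symmetric] algebra_simps)
    finally show "norm (f (of_real x) - b 0) \<le> S * exp ((p + 2) * ln 2) * exp (- (x * ln 2))" .
  qed
qed

lemma pick_matrix_halfplane_injective:
  fixes lam c :: "nat \<Rightarrow> complex"
  assumes \<phi>: "Hinf_unit_ball \<phi>" and D: "dirichlet_representable \<phi>"
    and inj: "inj_on lam {..<n}" and lam: "\<And>j. j < n \<Longrightarrow> Re (lam j) > 0"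
    and less1: "\<And>j. j < n \<Longrightarrow> norm (\<phi> (lam j)) < 1"
    and null: "\<And>i. i < n \<Longrightarrow> (\<Sum>j<n. (1 - cnj (\<phi> (lam i)) * \<phi> (lam j)) / (cnj (lam i) + lam j) * c j) = 0"
    and j: "j < n"
  shows "c j = 0"
proof -
  \<comment> \<open>The point \<open>s\<close> is adjoined as node number \<open>n\<close>. The
    enlarged Pick kernel is still positive semi-definite, so the null vector also annihilates the
    new row. No distinctness from the old nodes is required of \<open>s\<close>.\<close>
  have row: "(\<Sum>j<n. (1 - cnj (\<phi> s) * \<phi> (lam j)) / (cnj s + lam j) * c j) = 0" if s: "Re s > 0" for s
  proof -
    define l where "l = lam(n := s)"
    define K where "K i j = (1 - cnj (\<phi> (l i)) * \<phi> (l j)) / (cnj (l i) + l j)" for i j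
    have "psd_kernel (Suc n) K"
      unfolding K_def by (rule psd_kernel_halfplane[OF \<phi>]) (use s lam in \<open>auto simp: l_def less_Suc_eq\<close>)
    moreover have "K i n = cnj (K n i)" for i by (simp add: K_def mult.commute add.commute)
    moreover have "(\<Sum>i<n. \<Sum>j<n. cnj (c i) * K i j * c j) = 0"
    proof -
      have "(\<Sum>j<n. cnj (c i) * K i j * c j) = 0" if "i < n" for i
      proof -
        have "(\<Sum>j<n. cnj (c i) * K i j * c j) = cnj (c i) * (\<Sum>j<n. (1 - cnj (\<phi> (lam i)) * \<phi> (lam j)) / (cnj (lam i) + lam j) * c j)"
          unfolding sum_distrib_left using that by (intro sum.cong refl) (simp add: K_def l_def)
        then show ?thesis unfolding null[OF that] by simp
      qed
      then show ?thesis by simp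
    qed
    ultimately have "(\<Sum>j<n. K n j * c j) = 0" by (rule psd_kernel_null_row)
    moreover have "(\<Sum>j<n. K n j * c j) = (\<Sum>j<n. (1 - cnj (\<phi> s) * \<phi> (lam j)) / (cnj s + lam j) * c j)"
      by (intro sum.cong refl) (simp add: K_def l_def)
    ultimately show ?thesis by simp
  qed
  obtain a C x0 where a: "\<And>x. x \<ge> x0 \<Longrightarrow> norm (\<phi> (of_real x) - a) \<le> C * exp (- (x * ln 2))"
    by (rule dirichlet_exponential_limit[OF D]) (rule that)
  have "norm a \<le> 1"
  proof (rule tendsto_upperbound)
    have "((\<lambda>x. C * exp (- (x * ln 2))) \<longlongrightarrow> C * 0) at_top"
      by (intro tendsto_mult tendsto_const) real_asymp
    then have lim0: "((\<lambda>x. C * exp (- (x * ln 2))) \<longlongrightarrow> 0) at_top" by simp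
    have "((\<lambda>x. \<phi> (of_real x) - a) \<longlongrightarrow> 0) at_top"
      by (rule Lim_null_comparison[OF _ lim0], rule eventually_mono[OF eventually_ge_at_top[of x0]], rule a)
    then show "((\<lambda>x. norm (\<phi> (of_real x))) \<longlongrightarrow> norm a) at_top"
      by (intro tendsto_norm) (rule LIM_zero_cancel)
    show "\<forall>\<^sub>F x in at_top. norm (\<phi> (of_real x)) \<le> 1"
      using eventually_gt_at_top[of 0] by eventually_elim (use \<phi> in \<open>auto simp: Hinf_unit_ball_def\<close>)
  qed simp
  \<comment> \<open>With the denominators cleared, the relation \<open>row\<close> at \<open>s = x\<close> says that the polynomial \<open>g\<close> is exponentially small.\<close>
  define P where "P j = (\<Prod>i\<in>{..<n} - {j}. [:lam i, 1:])" for j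
  define h where "h = (\<Sum>j<n. Polynomial.smult (c j * \<phi> (lam j)) (P j))"
  define g where "g = (\<Sum>j<n. Polynomial.smult (c j * (1 - cnj a * \<phi> (lam j))) (P j))"
  \<comment> \<open>Replacing \<open>\<phi> x\<close> by its limit \<open>a\<close> in the cleared
    relation leaves \<open>g\<close>; the error of the replacement is what multiplies
    \<open>h\<close>.\<close>
  have g_eq: "poly g (of_real x) = cnj (\<phi> (of_real x) - a) * poly h (of_real x)" if x: "x > 0" for x
  proof -
    define R where "R = (\<Prod>i<n. of_real x + lam i)"
    have ne: "of_real x + lam j \<noteq> 0" if "j < n" for j
      using x lam[OF that] by (auto simp: complex_eq_iff)
    have PR: "poly (P j) (of_real x) = R / (of_real x + lam j)" if "j < n" for j
    proof -
      have "R = (of_real x + lam j) * (\<Prod>i\<in>{..<n} - {j}. of_real x + lam i)"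
        unfolding R_def using that by (intro prod.remove) auto
      then show ?thesis using ne[OF that] by (simp add: P_def poly_prod add.commute)
    qed
    have "poly g (of_real x) - cnj (\<phi> (of_real x) - a) * poly h (of_real x)
        = (\<Sum>j<n. (c j * (1 - cnj a * \<phi> (lam j)) - cnj (\<phi> (of_real x) - a) * (c j * \<phi> (lam j))) * poly (P j) (of_real x))"
      by (simp add: g_def h_def poly_sum sum_distrib_left sum_subtractf algebra_simps)
    also have "\<dots> = (\<Sum>j<n. R * ((1 - cnj (\<phi> (of_real x)) * \<phi> (lam j)) / (cnj (of_real x) + lam j) * c j))"
      by (intro sum.cong refl) (simp add: PR algebra_simps diff_divide_distrib)
    also have "\<dots> = R * 0"
      unfolding sum_distrib_left [symmetric] by (subst row) (use x in auto)
    finally show ?thesis by simp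
  qed
  have "((\<lambda>x. poly g (of_real x)) \<longlongrightarrow> 0) at_top"
  proof (rule Lim_null_comparison)
    have "((\<lambda>x. C * norm (poly h (of_real x) * of_real (exp (- (x * ln 2))))) \<longlongrightarrow> C * norm (0::complex)) at_top"
      by (intro tendsto_intros poly_times_exp_tendsto_0)
    then show "((\<lambda>x. C * norm (poly h (of_real x) * of_real (exp (- (x * ln 2))))) \<longlongrightarrow> 0) at_top" by simp
    show "\<forall>\<^sub>F x in at_top. norm (poly g (of_real x)) \<le> C * norm (poly h (of_real x) * of_real (exp (- (x * ln 2))))"
      using eventually_gt_at_top[of 0] eventually_ge_at_top[of x0]
    proof eventually_elim
      case (elim x)
      have "norm (poly g (of_real x)) = norm (\<phi> (of_real x) - a) * norm (poly h (of_real x))"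
        unfolding g_eq[OF elim(1)] norm_mult complex_mod_cnj ..
      also have "\<dots> \<le> C * exp (- (x * ln 2)) * norm (poly h (of_real x))"
        by (intro mult_right_mono a elim) simp
      finally show ?case by (simp add: norm_mult mult_ac)
    qed
  qed
  then have "g = 0" by (rule poly_eq_0_of_tendsto_0)
  \<comment> \<open>The \<open>P k\<close> form a Lagrange-type system: at \<open>- lam j\<close>
    all but \<open>P j\<close> vanish, and \<open>P j\<close> does not because the nodes are
    distinct.\<close>
  then have "0 = poly g (- lam j)" by simp
  also have "\<dots> = (\<Sum>k<n. c k * (1 - cnj a * \<phi> (lam k)) * poly (P k) (- lam j))"
    by (simp add: g_def poly_sum)
  also have "\<dots> = (\<Sum>k<n. if k = j then c k * (1 - cnj a * \<phi> (lam k)) * poly (P k) (- lam j) else 0)"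
  proof (rule sum.cong)
    fix k assume "k \<in> {..<n}"
    have "poly (P k) (- lam j) = 0" if "k \<noteq> j"
      unfolding P_def poly_prod using j that by (auto intro!: prod_zero bexI[of _ j])
    then show "c k * (1 - cnj a * \<phi> (lam k)) * poly (P k) (- lam j)
        = (if k = j then c k * (1 - cnj a * \<phi> (lam k)) * poly (P k) (- lam j) else 0)" by auto
  qed simp
  also have "\<dots> = c j * (1 - cnj a * \<phi> (lam j)) * poly (P j) (- lam j)" using j by simp
  finally have "c j * (1 - cnj a * \<phi> (lam j)) * poly (P j) (- lam j) = 0" by simp
  moreover have "poly (P j) (- lam j) \<noteq> 0"
    unfolding P_def poly_prod using inj j by (auto simp: inj_on_def)
  \<comment> \<open>The strict bound on \<open>\<phi> (lam j)\<close> enters here: together with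
    \<open>norm a \<le> 1\<close> it keeps the remaining factor of \<open>c j\<close> away from
    0.\<close>
  moreover have "cnj a * \<phi> (lam j) \<noteq> 1"
  proof
    assume "cnj a * \<phi> (lam j) = 1"
    then have "norm a * norm (\<phi> (lam j)) = 1" by (metis complex_mod_cnj norm_mult norm_one)
    moreover have "norm a * norm (\<phi> (lam j)) \<le> norm (\<phi> (lam j))"
      using \<open>norm a \<le> 1\<close> by (simp add: mult_left_le_one_le)
    ultimately show False using less1[OF j] by simp
  qed
  ultimately show ?thesis by simp
qed

section \<open>From kernels to matrices\<close>

lemma psd_mat_of_psd_kernel:
  assumes "psd_kernel n K"
  shows "psd_mat (mat n n (\<lambda>(i, j). K i j))"
  unfolding psd_mat_def Let_def
proof (intro conjI ballI)
  fix c :: "complex Matrix.vec"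
  have eq: "(\<Sum>i<dim_row (mat n n (\<lambda>(i, j). K i j)). \<Sum>j<dim_row (mat n n (\<lambda>(i, j). K i j)).
          cnj (vec_index c i) * mat n n (\<lambda>(i, j). K i j) $$ (i, j) * vec_index c j)
      = (\<Sum>i<n. \<Sum>j<n. cnj (vec_index c i) * K i j * vec_index c j)" (is "?q = _")
    by simp
  have "?q \<in> \<real>\<^sub>\<ge>\<^sub>0"
    unfolding eq using assms unfolding psd_kernel_def by blast
  then show "Im ?q = 0" "Re ?q \<ge> 0"
    by (auto simp only: complex_nonneg_Reals_iff)
qed simp

theorem theorem2p1:
  fixes n :: nat and lam w :: "nat \<Rightarrow> complex" and \<phi> :: "complex \<Rightarrow> complex"
  assumes distinct: "inj_on lam {..<n}"
    and lam_in: "\<forall>j<n. lam j \<in> halfplane (1/2)"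
    and w_in: "\<forall>j<n. norm (w j) < 1"
    and phi_Hinf: "Hinf_unit_ball \<phi>"
    and phi_D: "dirichlet_representable \<phi>"
    and interp: "\<forall>j<n. \<phi> (lam j) = w j"
  shows "psd_mat (mat n n (\<lambda>(i, j). (1 - cnj (w i) * w j) * zeta (cnj (lam i) + lam j)))
         \<and> psd_mat (mat n n (\<lambda>(i, j). (1 - cnj (w i) * w j) / (cnj (lam i) + lam j)))
         \<and> vec_space.rank n (mat n n (\<lambda>(i, j). (1 - cnj (w i) * w j) / (cnj (lam i) + lam j))) = n"
proof (intro conjI)
  have lam: "Re (lam j) > 1 / 2" if "j < n" for j using lam_in that by simp
  then have lam0: "Re (lam j) > 0" if "j < n" for j using that by fastforce
  have w: "\<phi> (lam j) = w j" if "j < n" for j using interp that by blast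
  have "psd_kernel n (\<lambda>i j. (1 - cnj (\<phi> (lam i)) * \<phi> (lam j)) * zeta (cnj (lam i) + lam j))"
    by (rule psd_kernel_zeta[OF phi_Hinf phi_D]) (rule lam)
  then have "psd_kernel n (\<lambda>i j. (1 - cnj (w i) * w j) * zeta (cnj (lam i) + lam j))"
    by (rule psd_kernel_cong[THEN iffD1, rotated]) (simp add: w)
  then show "psd_mat (mat n n (\<lambda>(i, j). (1 - cnj (w i) * w j) * zeta (cnj (lam i) + lam j)))"
    by (rule psd_mat_of_psd_kernel)
  have "psd_kernel n (\<lambda>i j. (1 - cnj (\<phi> (lam i)) * \<phi> (lam j)) / (cnj (lam i) + lam j))"
    by (rule psd_kernel_halfplane[OF phi_Hinf]) (rule lam0)
  then have "psd_kernel n (\<lambda>i j. (1 - cnj (w i) * w j) / (cnj (lam i) + lam j))"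
    by (rule psd_kernel_cong[THEN iffD1, rotated]) (simp add: w)
  then show "psd_mat (mat n n (\<lambda>(i, j). (1 - cnj (w i) * w j) / (cnj (lam i) + lam j)))"
    by (rule psd_mat_of_psd_kernel)
  define A where "A = mat n n (\<lambda>(i, j). (1 - cnj (w i) * w j) / (cnj (lam i) + lam j))"
  have A: "A \<in> carrier_mat n n" by (simp add: A_def)
  \<comment> \<open>Full rank is obtained through the determinant: a singular \<open>A\<close> has a
    nonzero kernel vector, and the rows of \<open>A\<close> applied to it are the null relations
    that force all its entries to vanish.\<close>
  have "det A \<noteq> 0"
  proof
    assume "det A = 0"
    then obtain v where v: "v \<in> carrier_vec n" "v \<noteq> 0\<^sub>v n" "A *\<^sub>v v = 0\<^sub>v n"
      using det_0_iff_vec_prod_zero_field[OF A] by blast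
    have null: "(\<Sum>j<n. (1 - cnj (\<phi> (lam i)) * \<phi> (lam j)) / (cnj (lam i) + lam j) * vec_index v j) = 0" if "i < n" for i
    proof -
      have "vec_index (A *\<^sub>v v) i = (\<Sum>j<n. (1 - cnj (w i) * w j) / (cnj (lam i) + lam j) * vec_index v j)"
        using that v(1) by (simp add: A_def scalar_prod_def atLeast0LessThan)
      then show ?thesis using that v(3) by (simp add: w)
    qed
    have "vec_index v j = 0" if "j < n" for j
    proof (rule pick_matrix_halfplane_injective[OF phi_Hinf phi_D distinct _ _ _ that])
      show "norm (\<phi> (lam k)) < 1" if "k < n" for k using that w_in by (simp add: w)
    qed (fact lam0 null)+
    then have "v = 0\<^sub>v n" using v(1) by (intro eq_vecI) auto
    with v(2) show False ..
  qed
  then show "vec_space.rank n (mat n n (\<lambda>(i, j). (1 - cnj (w i) * w j) / (cnj (lam i) + lam j))) = n"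
    using vec_space.low_rank_det_zero[OF A] unfolding A_def by blast
qed

end
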